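(* Let $\Gamma_{\mathcal T}$ be an $\tilde A_2$-group with shape function $\delta$ and associated $2$-graph $\Lambda_{\mathcal T}$. Let $\Sigma_{\mathcal T}:=\{(x,y)\in\Gamma_{\mathcal T}\times\Gamma_{\mathcal T}:\mathbf 1\le\delta(x^{-1}y)\}$ and $\Sigma_{\mathcal T}^0:=\{(x,y)\in\Gamma_{\mathcal T}\times\Gamma_{\mathcal T}:\delta(x^{-1}y)=\mathbf 1\}$, with $d(x,y):=\delta(x^{-1}y)-\mathbf 1$. For $(x,y)\in\Sigma_{\mathcal T}$ let $z_{x,y},w_{x,y}\in\Gamma_{\mathcal T}$ be the unique elements such that $$\delta(x^{-1}z_{x,y})=\delta(w_{x,y}^{-1}y)=\mathbf 1\quad\text{and}\quad\delta(x^{-1}y)=\delta(x^{-1}z_{x,y})+\delta(z_{x,y}^{-1}y)=\delta(x^{-1}w_{x,y})+\delta(w_{x,y}^{-1}y).$$ Define $r(x,y):=(x,z_{x,y})$, $s(x,y):=(w_{x,y},y)$, and $(x,y)(u,v):=(x,v)$ whenever $s(x,y)=r(u,v)$. With this structure $\Sigma_{\mathcal T}$ is a $2$-graph. Let $c:\Lambda_{\mathcal T}\to\Gamma_{\mathcal T}$ be the cocycle determined by $w=c(w)s(w)$ with $\delta(s(w))=\mathbf 1$, $\delta(c(w))=\delta(w)-\mathbf 1$. There is an isomorphism $\phi:\Sigma_{\mathcal T}\to\Gamma_{\mathcal T}\times_c\Lambda_{\mathcal T}$ such that $\phi(x,y)=(x,x^{-1}y)$ for all $(x,y)\in\Sigma_{\mathcal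 T}$. The inverse satisfies $\phi^{-1}(x,\lambda)=(x,x\lambda)$. There is a free action of $\Gamma_{\mathcal T}$ on $\Sigma_{\mathcal T}$ given by $g\cdot(x,y):=(gx,gy)$, and $\phi$ is equivariant for this action and the left action of $\Gamma_{\mathcal T}$ on $\Gamma_{\mathcal T}\times_c\Lambda_{\mathcal T}$ by translation in the first coordinate. In particular, $\phi$ descends to an isomorphism $\widetilde\phi:\Gamma_{\mathcal T}\backslash\Sigma_{\mathcal T}\to\Lambda_{\mathcal T}$ such that $\widetilde\phi([x,y])=x^{-1}y$.
   Context: $\tilde A_2$-groups. A finite projective plane $(P,L)$ of order $q$ consists of finite sets $P$ (points), $L$ (lines), $|P|=|L|=q^2+q+1$, and an incidence relation $\in$ from $P$ to $L$ such that any two distinct points lie on exactly one common line, any two distinct lines contain exactly one common point, and there are four distinct points no three of which are on one line. Given a bijection $\lambda:P\to L$, a triella compatible with $\lambda$ is a set $\mathcal T\subset P\times P\times P$ such that: (T1) for $x,y\in P$ there exists $z\in P$ with $(x,y,z)\in\mathcal T$ iff $y\in\lambda(x)$; (T2) $(x,y,z)\in\mathcal T\Rightarrow(y,z,x)\in\mathcal T$; (T3) for $x,y\in P$ there is at most one $z\in P$ with $(x,y,z)\in\mathcal T$. The associated $\tilde A_2$-group is $\Gamma_{\mathcal T}=\langle a_x,\ x\in P\mid a_xa_ya_z=1\text{ for each }(x,y,z)\in\mathcal T\rangle$. Shape function. It is known that every $w\in\Gamma_{\mathcal T}$ can be written with unique $m,n\ge0$ and unique $x_i,y_j\in P$ as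 $w=a_{x_1}\cdots a_{x_m}a_{y_1}^{-1}\cdots a_{y_n}^{-1}$ where $x_{i+1}\notin\lambda(x_i)$ for $1\le i<m$, $y_j\notin\lambda(y_{j+1})$ for $1\le j<n$, and $x_m\ne y_1$ if $m,n\ge1$. Define $\delta(w)=(m,n)\in\mathbb{N}^2$. Write $\mathbf 1=(1,1)$; $\le$ on $\mathbb{N}^2$ is coordinatewise. Unique factorisation holds: if $\delta(w)=m+n$ with $m,n\in\mathbb{N}^2$ there are unique $h,k\in\Gamma_{\mathcal T}$ with $w=hk$, $\delta(h)=m$, $\delta(k)=n$. A $2$-graph is a small category $\Lambda$ (identified with its morphisms; objects identified with identity morphisms $\Lambda^0$) with a functor $d:\Lambda\to\mathbb{N}^2$ such that if $d(\lambda)=m+n$ there are unique $\mu,\nu$ with $d(\mu)=m$, $d(\nu)=n$, $\lambda=\mu\nu$; $\lambda\mu$ is defined iff $s(\lambda)=r(\mu)$. Isomorphisms are degree-preserving. The $2$-graph $\Lambda_{\mathcal T}$: $\Lambda_{\mathcal T}=\{w\in\Gamma_{\mathcal T}:\delta(w)\ge\mathbf 1\}$, $\Lambda^0_{\mathcal T}=\{u:\delta(u)=\mathbf 1\}$, degree $d(w)=\delta(w)-\mathbf 1$; $r,s,b,c$ are given by the unique factorisations $w=r(w)b(w)=c(w)s(w)$ with $\delta(r(w))=\delta(s(w))=\mathbf 1$, $\delta(b(w))=\delta(c(w))=\delta(w)-\mathbf 1$; composition is $\lambda\circ\mu=c(\lambda)s(\lambda)b(\mu)$ when $s(\lambda)=r(\mu)$.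 This is a $2$-graph and $c$ is a $1$-cocycle (functor to a group). For a $1$-cocycle $c:\Lambda\to G$ into a group, the skew product $G\times_c\Lambda$ is the $2$-graph with set $G\times\Lambda$, $r(g,\lambda)=(g,r(\lambda))$, $s(g,\lambda)=(gc(\lambda),s(\lambda))$, $(g,\lambda)(gc(\lambda),\mu)=(g,\lambda\mu)$, $d(g,\lambda)=d(\lambda)$; $G$ acts by translation on the first coordinate. For a free action of a group $G$ on a $2$-graph $\Sigma$ by automorphisms, the orbit set $G\backslash\Sigma$ is a $2$-graph with the induced structure. *)

theory Defs
  imports "HOL-Library.Product_Order" "HOL-Library.Product_Plus" "HOL-Algebra.Group_Action"
begin

text \<open>Pairs of naturals carry the coordinatewise order, addition and (truncated) subtraction
  of Product_Order and Product_Plus.\<close>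

section \<open>Group presentations\<close>

text \<open>The letter \<open>(x, True)\<close> stands for the generator \<open>a\<^sub>x\<close>, the letter \<open>(x, False)\<close> for its
  formal inverse.\<close>

type_synonym 'a gword = "('a \<times> bool) list"

definition gwords :: "'a set \<Rightarrow> 'a gword set" where
  "gwords X = lists (X \<times> UNIV)"

inductive word_eq :: "'a set \<Rightarrow> 'a gword set \<Rightarrow> 'a gword \<Rightarrow> 'a gword \<Rightarrow> bool"
  for X :: "'a set" and R :: "'a gword set" where
  refl: "u \<in> gwords X \<Longrightarrow> word_eq X R u u"
| sym: "word_eq X R u v \<Longrightarrow> word_eq X R v u"
| trans: "word_eq X R u v \<Longrightarrow> word_eq X R v w \<Longrightarrow> word_eq X R u w"
| app: "word_eq X R u u' \<Longrightarrow> word_eq X R v v' \<Longrightarrow> word_eq X R (u @ v) (u' @ v')"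
| cancel: "x \<in> X \<Longrightarrow> word_eq X R [(x, e), (x, \<not> e)] []"
| relator: "u \<in> R \<Longrightarrow> u \<in> gwords X \<Longrightarrow> word_eq X R u []"

definition word_class :: "'a set \<Rightarrow> 'a gword set \<Rightarrow> 'a gword \<Rightarrow> 'a gword set" where
  "word_class X R u = {v. word_eq X R u v}"

definition presented_group :: "'a set \<Rightarrow> 'a gword set \<Rightarrow> 'a gword set monoid" where
  "presented_group X R =
     \<lparr>carrier = word_class X R ` gwords X,
      monoid.mult = (\<lambda>A B. \<Union>u\<in>A. \<Union>v\<in>B. word_class X R (u @ v)),
      one = word_class X R []\<rparr>"

definition gword_inv :: "'a gword \<Rightarrow> 'a gword" where
  "gword_inv u = rev (map (\<lambda>(x, e). (x, \<not> e)) u)"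

lemma word_eq_gwords: "word_eq X R u v \<Longrightarrow> u \<in> gwords X \<and> v \<in> gwords X"
  by (induction rule: word_eq.induct) (auto simp: gwords_def)

lemma word_class_eq_iff:
  assumes "u \<in> gwords X"
  shows "word_class X R u = word_class X R v \<longleftrightarrow> word_eq X R u v"
  using assms unfolding word_class_def
  by (auto intro: word_eq.refl dest: word_eq.sym word_eq.trans)

lemma presented_group_mult:
  assumes "u \<in> gwords X" "v \<in> gwords X"
  shows "word_class X R u \<otimes>\<^bsub>presented_group X R\<^esub> word_class X R v = word_class X R (u @ v)"
proof -
  have "word_class X R (u' @ v') = word_class X R (u @ v)"
    if "word_eq X R u u'" "word_eq X R v v'" for u' v'
  proof -
    have eq: "word_eq X R (u @ v) (u' @ v')" using that by (rule word_eq.app)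
    then show ?thesis using word_class_eq_iff word_eq_gwords by blast
  qed
  then have "word_class X R (u' @ v') = word_class X R (u @ v)"
    if "u' \<in> word_class X R u" "v' \<in> word_class X R v" for u' v'
    using that unfolding word_class_def by blast
  moreover have "u \<in> word_class X R u" "v \<in> word_class X R v"
    using assms unfolding word_class_def by (blast intro: word_eq.refl)+
  ultimately have "(\<Union>u'\<in>word_class X R u. \<Union>v'\<in>word_class X R v. word_class X R (u' @ v'))
      = word_class X R (u @ v)"
    by blast
  then show ?thesis by (simp add: presented_group_def)
qed

lemma gword_inv_in [simp]: "u \<in> gwords X \<Longrightarrow> gword_inv u \<in> gwords X"
  unfolding gwords_def gword_inv_def by auto

lemma gword_inv_cancel: "u \<in> gwords X \<Longrightarrow> word_eq X R (gword_inv u @ u) []"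
proof (induction u)
  case Nil
  then show ?case by (simp add: gword_inv_def word_eq.refl)
next
  case (Cons a u)
  obtain x e where a: "a = (x, e)" by (cases a)
  have x: "x \<in> X" and u: "u \<in> gwords X" using Cons.prems a by (auto simp: gwords_def)
  have "word_eq X R [(x, \<not> e), (x, e)] []"
    using word_eq.cancel[OF x, of R "\<not> e"] by simp
  then have "word_eq X R (gword_inv u @ ([(x, \<not> e), (x, e)] @ u)) (gword_inv u @ ([] @ u))"
    using u by (intro word_eq.app word_eq.refl) auto
  then have "word_eq X R (gword_inv (a # u) @ a # u) (gword_inv u @ u)"
    by (simp add: a gword_inv_def)
  then show ?case using Cons.IH[OF u] by (rule word_eq.trans)
qed

lemma group_presented_group: "group (presented_group X R)"
proof (rule groupI)
  let ?G = "presented_group X R"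
  have car: "carrier ?G = word_class X R ` gwords X" and one: "\<one>\<^bsub>?G\<^esub> = word_class X R []"
    by (simp_all add: presented_group_def)
  have nil: "[] \<in> gwords X" and app: "u \<in> gwords X \<Longrightarrow> v \<in> gwords X \<Longrightarrow> u @ v \<in> gwords X" for u v
    by (auto simp: gwords_def)
  show "\<one>\<^bsub>?G\<^esub> \<in> carrier ?G" using car one nil by simp
  fix A assume "A \<in> carrier ?G"
  then obtain u where u: "u \<in> gwords X" "A = word_class X R u" using car by auto
  show "\<one>\<^bsub>?G\<^esub> \<otimes>\<^bsub>?G\<^esub> A = A" using u nil by (simp add: one presented_group_mult)
  have "word_class X R (gword_inv u) \<otimes>\<^bsub>?G\<^esub> A = \<one>\<^bsub>?G\<^esub>"
    using u gword_inv_cancel[OF u(1), of R]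
    by (simp add: one presented_group_mult word_class_eq_iff app)
  then show "\<exists>B\<in>carrier ?G. B \<otimes>\<^bsub>?G\<^esub> A = \<one>\<^bsub>?G\<^esub>" using car u by auto
  fix B assume "B \<in> carrier ?G"
  then obtain v where v: "v \<in> gwords X" "B = word_class X R v" using car by auto
  show "A \<otimes>\<^bsub>?G\<^esub> B \<in> carrier ?G" using u v car app by (simp add: presented_group_mult)
  fix C assume "C \<in> carrier ?G"
  then obtain w where w: "w \<in> gwords X" "C = word_class X R w" using car by auto
  show "A \<otimes>\<^bsub>?G\<^esub> B \<otimes>\<^bsub>?G\<^esub> C = A \<otimes>\<^bsub>?G\<^esub> (B \<otimes>\<^bsub>?G\<^esub> C)"
    using u v w app by (simp add: presented_group_mult)
qed

section \<open>Projective planes, triellas and their groups\<close>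

locale finite_projective_plane =
  fixes P :: "'p set" and L :: "'l set" and on :: "'p \<Rightarrow> 'l \<Rightarrow> bool" and q :: nat
  assumes finite_points: "finite P" and finite_lines: "finite L"
    and card_points: "card P = q ^ 2 + q + 1" and card_lines: "card L = q ^ 2 + q + 1"
    and unique_line: "x \<in> P \<Longrightarrow> y \<in> P \<Longrightarrow> x \<noteq> y \<Longrightarrow> \<exists>!l. l \<in> L \<and> on x l \<and> on y l"
    and unique_point: "l \<in> L \<Longrightarrow> k \<in> L \<Longrightarrow> l \<noteq> k \<Longrightarrow> \<exists>!x. x \<in> P \<and> on x l \<and> on x k"
    and quadrangle: "\<exists>Q\<subseteq>P. card Q = 4 \<and>
      (\<forall>S\<subseteq>Q. card S = 3 \<longrightarrow> \<not> (\<exists>l\<in>L. \<forall>x\<in>S. on x l))"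

locale triella = finite_projective_plane P L on q
  for P :: "'p set" and L :: "'l set" and on :: "'p \<Rightarrow> 'l \<Rightarrow> bool" and q :: nat +
  fixes lam :: "'p \<Rightarrow> 'l" and T :: "('p \<times> 'p \<times> 'p) set"
  assumes lam_bij: "bij_betw lam P L"
    and T_subset: "T \<subseteq> P \<times> P \<times> P"
    and T1: "x \<in> P \<Longrightarrow> y \<in> P \<Longrightarrow> (\<exists>z\<in>P. (x, y, z) \<in> T) \<longleftrightarrow> on y (lam x)"
    and T2: "(x, y, z) \<in> T \<Longrightarrow> (y, z, x) \<in> T"
    and T3: "(x, y, z) \<in> T \<Longrightarrow> (x, y, z') \<in> T \<Longrightarrow> z = z'"

definition triella_relators :: "('p \<times> 'p \<times> 'p) set \<Rightarrow> 'p gword set" where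
  "triella_relators T = {[(x, True), (y, True), (z, True)] | x y z. (x, y, z) \<in> T}"

definition A2_group :: "'p set \<Rightarrow> ('p \<times> 'p \<times> 'p) set \<Rightarrow> 'p gword set monoid" where
  "A2_group P T = presented_group P (triella_relators T)"

definition A2_gen :: "'p set \<Rightarrow> ('p \<times> 'p \<times> 'p) set \<Rightarrow> 'p \<Rightarrow> 'p gword set" where
  "A2_gen P T x = word_class P (triella_relators T) [(x, True)]"

definition A2_normal_form ::
  "'p set \<Rightarrow> ('p \<Rightarrow> 'l \<Rightarrow> bool) \<Rightarrow> ('p \<Rightarrow> 'l) \<Rightarrow> ('p \<times> 'p \<times> 'p) set
    \<Rightarrow> 'p gword set \<Rightarrow> 'p list \<Rightarrow> 'p list \<Rightarrow> bool" where
  "A2_normal_form P on lam T w xs ys \<longleftrightarrow>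
     xs \<in> lists P \<and> ys \<in> lists P \<and>
     w = foldr (monoid.mult (A2_group P T))
           (map (A2_gen P T) xs @ map (\<lambda>y. inv\<^bsub>A2_group P T\<^esub> (A2_gen P T y)) ys)
           \<one>\<^bsub>A2_group P T\<^esub> \<and>
     successively (\<lambda>x x'. \<not> on x' (lam x)) xs \<and>
     successively (\<lambda>y y'. \<not> on y (lam y')) ys \<and>
     (xs \<noteq> [] \<and> ys \<noteq> [] \<longrightarrow> last xs \<noteq> hd ys)"

definition A2_shape ::
  "'p set \<Rightarrow> ('p \<Rightarrow> 'l \<Rightarrow> bool) \<Rightarrow> ('p \<Rightarrow> 'l) \<Rightarrow> ('p \<times> 'p \<times> 'p) set
    \<Rightarrow> 'p gword set \<Rightarrow> nat \<times> nat" where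
  "A2_shape P on lam T w =
     (THE mn. \<exists>xs ys. A2_normal_form P on lam T w xs ys \<and> mn = (length xs, length ys))"

section \<open>2-graphs\<close>

text \<open>A category given by its morphisms, objects being identified with identity morphisms.
  \<open>Cmp f g\<close> is meaningful only when \<open>Src f = Rng g\<close>.\<close>

record 'a twograph =
  Mor :: "'a set"
  Obj :: "'a set"
  Rng :: "'a \<Rightarrow> 'a"
  Src :: "'a \<Rightarrow> 'a"
  Cmp :: "'a \<Rightarrow> 'a \<Rightarrow> 'a"
  Deg :: "'a \<Rightarrow> nat \<times> nat"

locale two_graph =
  fixes \<Lambda> :: "'a twograph"
  assumes Obj_subset: "Obj \<Lambda> \<subseteq> Mor \<Lambda>"
    and Rng_closed: "f \<in> Mor \<Lambda> \<Longrightarrow> Rng \<Lambda> f \<in> Obj \<Lambda>"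
    and Src_closed: "f \<in> Mor \<Lambda> \<Longrightarrow> Src \<Lambda> f \<in> Obj \<Lambda>"
    and Rng_Obj: "v \<in> Obj \<Lambda> \<Longrightarrow> Rng \<Lambda> v = v"
    and Src_Obj: "v \<in> Obj \<Lambda> \<Longrightarrow> Src \<Lambda> v = v"
    and Cmp_closed: "f \<in> Mor \<Lambda> \<Longrightarrow> g \<in> Mor \<Lambda> \<Longrightarrow> Src \<Lambda> f = Rng \<Lambda> g \<Longrightarrow> Cmp \<Lambda> f g \<in> Mor \<Lambda>"
    and Rng_Cmp: "f \<in> Mor \<Lambda> \<Longrightarrow> g \<in> Mor \<Lambda> \<Longrightarrow> Src \<Lambda> f = Rng \<Lambda> g
      \<Longrightarrow> Rng \<Lambda> (Cmp \<Lambda> f g) = Rng \<Lambda> f"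
    and Src_Cmp: "f \<in> Mor \<Lambda> \<Longrightarrow> g \<in> Mor \<Lambda> \<Longrightarrow> Src \<Lambda> f = Rng \<Lambda> g
      \<Longrightarrow> Src \<Lambda> (Cmp \<Lambda> f g) = Src \<Lambda> g"
    and Cmp_assoc: "f \<in> Mor \<Lambda> \<Longrightarrow> g \<in> Mor \<Lambda> \<Longrightarrow> h \<in> Mor \<Lambda>
      \<Longrightarrow> Src \<Lambda> f = Rng \<Lambda> g \<Longrightarrow> Src \<Lambda> g = Rng \<Lambda> h
      \<Longrightarrow> Cmp \<Lambda> (Cmp \<Lambda> f g) h = Cmp \<Lambda> f (Cmp \<Lambda> g h)"
    and Cmp_Rng: "f \<in> Mor \<Lambda> \<Longrightarrow> Cmp \<Lambda> (Rng \<Lambda> f) f = f"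
    and Cmp_Src: "f \<in> Mor \<Lambda> \<Longrightarrow> Cmp \<Lambda> f (Src \<Lambda> f) = f"
    and Deg_Obj: "v \<in> Obj \<Lambda> \<Longrightarrow> Deg \<Lambda> v = (0, 0)"
    and Deg_Cmp: "f \<in> Mor \<Lambda> \<Longrightarrow> g \<in> Mor \<Lambda> \<Longrightarrow> Src \<Lambda> f = Rng \<Lambda> g
      \<Longrightarrow> Deg \<Lambda> (Cmp \<Lambda> f g) = Deg \<Lambda> f + Deg \<Lambda> g"
    and factorisation: "f \<in> Mor \<Lambda> \<Longrightarrow> Deg \<Lambda> f = m + n
      \<Longrightarrow> \<exists>!(g, h). g \<in> Mor \<Lambda> \<and> h \<in> Mor \<Lambda> \<and> Src \<Lambda> g = Rng \<Lambda> h
            \<and> Deg \<Lambda> g = m \<and> Deg \<Lambda> h = n \<and> f = Cmp \<Lambda> g h"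

definition two_graph_iso :: "'a twograph \<Rightarrow> 'b twograph \<Rightarrow> ('a \<Rightarrow> 'b) \<Rightarrow> bool" where
  "two_graph_iso \<Lambda> M \<phi> \<longleftrightarrow>
     two_graph \<Lambda> \<and> two_graph M \<and> bij_betw \<phi> (Mor \<Lambda>) (Mor M) \<and> \<phi> ` Obj \<Lambda> = Obj M \<and>
     (\<forall>f\<in>Mor \<Lambda>. Rng M (\<phi> f) = \<phi> (Rng \<Lambda> f) \<and> Src M (\<phi> f) = \<phi> (Src \<Lambda> f) \<and> Deg M (\<phi> f) = Deg \<Lambda> f) \<and>
     (\<forall>f\<in>Mor \<Lambda>. \<forall>g\<in>Mor \<Lambda>. Src \<Lambda> f = Rng \<Lambda> g \<longrightarrow> \<phi> (Cmp \<Lambda> f g) = Cmp M (\<phi> f) (\<phi> g))"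

definition cocycle :: "('g, 'm) monoid_scheme \<Rightarrow> 'a twograph \<Rightarrow> ('a \<Rightarrow> 'g) \<Rightarrow> bool" where
  "cocycle G \<Lambda> c \<longleftrightarrow>
     (\<forall>f\<in>Mor \<Lambda>. c f \<in> carrier G) \<and> (\<forall>v\<in>Obj \<Lambda>. c v = \<one>\<^bsub>G\<^esub>) \<and>
     (\<forall>f\<in>Mor \<Lambda>. \<forall>g\<in>Mor \<Lambda>. Src \<Lambda> f = Rng \<Lambda> g \<longrightarrow> c (Cmp \<Lambda> f g) = c f \<otimes>\<^bsub>G\<^esub> c g)"

definition skew_product ::
  "('g, 'm) monoid_scheme \<Rightarrow> ('a \<Rightarrow> 'g) \<Rightarrow> 'a twograph \<Rightarrow> ('g \<times> 'a) twograph" where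
  "skew_product G c \<Lambda> =
     \<lparr>Mor = carrier G \<times> Mor \<Lambda>,
      Obj = carrier G \<times> Obj \<Lambda>,
      Rng = (\<lambda>(g, f). (g, Rng \<Lambda> f)),
      Src = (\<lambda>(g, f). (g \<otimes>\<^bsub>G\<^esub> c f, Src \<Lambda> f)),
      Cmp = (\<lambda>(g, f) (h, f'). (g, Cmp \<Lambda> f f')),
      Deg = (\<lambda>(g, f). Deg \<Lambda> f)\<rparr>"

text \<open>Actions are restricted to the set of morphisms because \<open>group_action\<close> of HOL-Algebra maps into
  \<open>BijGroup\<close>, whose elements are extensional functions.\<close>

definition skew_translation ::
  "('g, 'm) monoid_scheme \<Rightarrow> ('a \<Rightarrow> 'g) \<Rightarrow> 'a twograph \<Rightarrow> 'g \<Rightarrow> 'g \<times> 'a \<Rightarrow> 'g \<times> 'a" where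
  "skew_translation G c \<Lambda> g = (\<lambda>(h, f)\<in>Mor (skew_product G c \<Lambda>). (g \<otimes>\<^bsub>G\<^esub> h, f))"

definition free_two_graph_action ::
  "('g, 'm) monoid_scheme \<Rightarrow> 'a twograph \<Rightarrow> ('g \<Rightarrow> 'a \<Rightarrow> 'a) \<Rightarrow> bool" where
  "free_two_graph_action G \<Sigma> act \<longleftrightarrow>
     group_action G (Mor \<Sigma>) act \<and>
     (\<forall>g\<in>carrier G. two_graph_iso \<Sigma> \<Sigma> (act g)) \<and>
     (\<forall>g\<in>carrier G. \<forall>f\<in>Mor \<Sigma>. act g f = f \<longrightarrow> g = \<one>\<^bsub>G\<^esub>)"

text \<open>The structure maps of the quotient are read off from representatives; for a free action,
  \<open>[f][g] = [f g']\<close> where \<open>g'\<close> is any representative of \<open>[g]\<close> composable with \<open>f\<close>.\<close>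

definition quotient_two_graph ::
  "('g, 'm) monoid_scheme \<Rightarrow> ('g \<Rightarrow> 'a \<Rightarrow> 'a) \<Rightarrow> 'a twograph \<Rightarrow> 'a set twograph" where
  "quotient_two_graph G act \<Sigma> =
     \<lparr>Mor = orbits G (Mor \<Sigma>) act,
      Obj = orbits G (Obj \<Sigma>) act,
      Rng = (\<lambda>A. \<Union>f\<in>A. orbit G act (Rng \<Sigma> f)),
      Src = (\<lambda>A. \<Union>f\<in>A. orbit G act (Src \<Sigma> f)),
      Cmp = (\<lambda>A B. \<Union>f\<in>A. \<Union>g\<in>{g \<in> B. Src \<Sigma> f = Rng \<Sigma> g}. orbit G act (Cmp \<Sigma> f g)),
      Deg = (\<lambda>A. the_elem (Deg \<Sigma> ` A))\<rparr>"

section \<open>The 2-graphs attached to a group with a shape function\<close>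

definition shape_factor ::
  "('g, 'm) monoid_scheme \<Rightarrow> ('g \<Rightarrow> nat \<times> nat) \<Rightarrow> nat \<times> nat \<Rightarrow> nat \<times> nat \<Rightarrow> 'g \<Rightarrow> 'g \<times> 'g" where
  "shape_factor G \<delta> m n w =
     (THE (h, k). h \<in> carrier G \<and> k \<in> carrier G \<and> w = h \<otimes>\<^bsub>G\<^esub> k \<and> \<delta> h = m \<and> \<delta> k = n)"

text \<open>The unique factorisations \<open>w = r(w) b(w) = c(w) s(w)\<close>. They are used only when
  \<open>(1, 1) \<le> \<delta> w\<close>, so that \<open>\<delta> w - (1, 1)\<close> is not truncated.\<close>

definition Lambda_r :: "('g, 'm) monoid_scheme \<Rightarrow> ('g \<Rightarrow> nat \<times> nat) \<Rightarrow> 'g \<Rightarrow> 'g" where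
  "Lambda_r G \<delta> w = fst (shape_factor G \<delta> (1, 1) (\<delta> w - (1, 1)) w)"

definition Lambda_b :: "('g, 'm) monoid_scheme \<Rightarrow> ('g \<Rightarrow> nat \<times> nat) \<Rightarrow> 'g \<Rightarrow> 'g" where
  "Lambda_b G \<delta> w = snd (shape_factor G \<delta> (1, 1) (\<delta> w - (1, 1)) w)"

definition Lambda_c :: "('g, 'm) monoid_scheme \<Rightarrow> ('g \<Rightarrow> nat \<times> nat) \<Rightarrow> 'g \<Rightarrow> 'g" where
  "Lambda_c G \<delta> w = fst (shape_factor G \<delta> (\<delta> w - (1, 1)) (1, 1) w)"

definition Lambda_s :: "('g, 'm) monoid_scheme \<Rightarrow> ('g \<Rightarrow> nat \<times> nat) \<Rightarrow> 'g \<Rightarrow> 'g" where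
  "Lambda_s G \<delta> w = snd (shape_factor G \<delta> (\<delta> w - (1, 1)) (1, 1) w)"

definition Lambda_graph :: "('g, 'm) monoid_scheme \<Rightarrow> ('g \<Rightarrow> nat \<times> nat) \<Rightarrow> 'g twograph" where
  "Lambda_graph G \<delta> =
     \<lparr>Mor = {w \<in> carrier G. (1, 1) \<le> \<delta> w},
      Obj = {w \<in> carrier G. \<delta> w = (1, 1)},
      Rng = Lambda_r G \<delta>,
      Src = Lambda_s G \<delta>,
      Cmp = (\<lambda>f g. Lambda_c G \<delta> f \<otimes>\<^bsub>G\<^esub> Lambda_s G \<delta> f \<otimes>\<^bsub>G\<^esub> Lambda_b G \<delta> g),
      Deg = (\<lambda>w. \<delta> w - (1, 1))\<rparr>"

definition is_Sigma_z ::
  "('g, 'm) monoid_scheme \<Rightarrow> ('g \<Rightarrow> nat \<times> nat) \<Rightarrow> 'g \<Rightarrow> 'g \<Rightarrow> 'g \<Rightarrow> bool" where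
  "is_Sigma_z G \<delta> x y z \<longleftrightarrow>
     z \<in> carrier G \<and> \<delta> (inv\<^bsub>G\<^esub> x \<otimes>\<^bsub>G\<^esub> z) = (1, 1) \<and>
     \<delta> (inv\<^bsub>G\<^esub> x \<otimes>\<^bsub>G\<^esub> y) = \<delta> (inv\<^bsub>G\<^esub> x \<otimes>\<^bsub>G\<^esub> z) + \<delta> (inv\<^bsub>G\<^esub> z \<otimes>\<^bsub>G\<^esub> y)"

definition is_Sigma_w ::
  "('g, 'm) monoid_scheme \<Rightarrow> ('g \<Rightarrow> nat \<times> nat) \<Rightarrow> 'g \<Rightarrow> 'g \<Rightarrow> 'g \<Rightarrow> bool" where
  "is_Sigma_w G \<delta> x y w \<longleftrightarrow>
     w \<in> carrier G \<and> \<delta> (inv\<^bsub>G\<^esub> w \<otimes>\<^bsub>G\<^esub> y) = (1, 1) \<and>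
     \<delta> (inv\<^bsub>G\<^esub> x \<otimes>\<^bsub>G\<^esub> y) = \<delta> (inv\<^bsub>G\<^esub> x \<otimes>\<^bsub>G\<^esub> w) + \<delta> (inv\<^bsub>G\<^esub> w \<otimes>\<^bsub>G\<^esub> y)"

definition Sigma_graph :: "('g, 'm) monoid_scheme \<Rightarrow> ('g \<Rightarrow> nat \<times> nat) \<Rightarrow> ('g \<times> 'g) twograph" where
  "Sigma_graph G \<delta> =
     \<lparr>Mor = {(x, y) \<in> carrier G \<times> carrier G. (1, 1) \<le> \<delta> (inv\<^bsub>G\<^esub> x \<otimes>\<^bsub>G\<^esub> y)},
      Obj = {(x, y) \<in> carrier G \<times> carrier G. \<delta> (inv\<^bsub>G\<^esub> x \<otimes>\<^bsub>G\<^esub> y) = (1, 1)},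
      Rng = (\<lambda>(x, y). (x, THE z. is_Sigma_z G \<delta> x y z)),
      Src = (\<lambda>(x, y). (THE w. is_Sigma_w G \<delta> x y w, y)),
      Cmp = (\<lambda>(x, y) (u, v). (x, v)),
      Deg = (\<lambda>(x, y). \<delta> (inv\<^bsub>G\<^esub> x \<otimes>\<^bsub>G\<^esub> y) - (1, 1))\<rparr>"

definition Sigma_action ::
  "('g, 'm) monoid_scheme \<Rightarrow> ('g \<Rightarrow> nat \<times> nat) \<Rightarrow> 'g \<Rightarrow> 'g \<times> 'g \<Rightarrow> 'g \<times> 'g" where
  "Sigma_action G \<delta> g = (\<lambda>(x, y)\<in>Mor (Sigma_graph G \<delta>). (g \<otimes>\<^bsub>G\<^esub> x, g \<otimes>\<^bsub>G\<^esub> y))"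

end

theory Submission
  imports Defs
begin

text \<open>
  Only the following consequences of the plane axioms matter: \<open>T\<close> is invariant under rotation, two
  entries of a triple determine the third, and any two distinct points are joined by, respectively
  meet in, a unique third one.  These conditions are self-dual: they are preserved by reversing the
  triples while exchanging generators and inverses.

  The rewriting rules \<open>a\<^sub>x a\<^sub>y \<rightarrow> a\<^sub>z\<^sup>-\<^sup>1\<close> and \<open>a\<^sub>y\<^sup>-\<^sup>1 a\<^sub>x\<^sup>-\<^sup>1 \<rightarrow> a\<^sub>z\<close> for \<open>(x, y, z) \<in> T\<close>, free cancellation, and
  \<open>a\<^sub>x\<^sup>-\<^sup>1 a\<^sub>y \<rightarrow> a\<^sub>u a\<^sub>v\<^sup>-\<^sup>1\<close> for \<open>(t, x, u), (t, y, v) \<in> T\<close> terminate and are confluent, so every element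
  has a unique reduced form ``positive letters, then negative letters''.  By duality there is also a
  unique reduced form with the negative letters first, and both kinds of reduced words are
  geodesic.  Since only the last rule preserves length, and it also preserves the numbers of positive
  and negative letters, the shape of an element can be read off from any geodesic word.  Comparing the
  two normal forms yields unique factorisation, and the fact that geodesics glue along a common piece
  of shape \<open>(1, 1)\<close>, which is exactly what composition in \<open>\<Lambda>\<close> needs.

  The map \<open>(x, y) \<mapsto> (x, x\<^sup>-\<^sup>1 y)\<close> then transports the skew product structure to \<open>\<Sigma>\<close>, and the orbits of
  the action are the fibres of \<open>(x, y) \<mapsto> x\<^sup>-\<^sup>1 y\<close>.
\<close>

section \<open>Triangle presentations and their normal forms\<close>

text \<open>Well-founded induction on the common source. Local confluence joins the two first steps;
  the induction hypothesis at \<open>y1\<close> then absorbs the rest of the first path, and the one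
  at \<open>z1\<close> the rest of the second.\<close>

lemma newman:
  assumes wf: "wfp (\<lambda>y x. R x y)"
    and loc: "\<And>x y z. R x y \<Longrightarrow> R x z \<Longrightarrow> \<exists>w. R\<^sup>*\<^sup>* y w \<and> R\<^sup>*\<^sup>* z w"
  shows "R\<^sup>*\<^sup>* x y \<Longrightarrow> R\<^sup>*\<^sup>* x z \<Longrightarrow> \<exists>w. R\<^sup>*\<^sup>* y w \<and> R\<^sup>*\<^sup>* z w"
  using wf
proof (induction x arbitrary: y z rule: wfp_induct_rule)
  case (less x)
  show ?case
  proof (cases "x = y \<or> x = z")
    case True
    then show ?thesis using less.prems by blast
  next
    case False
    then obtain y1 z1 where y1: "R x y1" "R\<^sup>*\<^sup>* y1 y" and z1: "R x z1" "R\<^sup>*\<^sup>* z1 z"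
      using less.prems by (metis converse_rtranclpE)
    obtain w1 where w1: "R\<^sup>*\<^sup>* y1 w1" "R\<^sup>*\<^sup>* z1 w1" using loc y1(1) z1(1) by blast
    obtain w2 where w2: "R\<^sup>*\<^sup>* y w2" "R\<^sup>*\<^sup>* w1 w2" using less.IH[OF y1(1) y1(2) w1(1)] by blast
    have "R\<^sup>*\<^sup>* z1 w2" using w1(2) w2(2) by simp
    then obtain w3 where "R\<^sup>*\<^sup>* w2 w3" "R\<^sup>*\<^sup>* z w3" using less.IH[OF z1(1) _ z1(2)] by blast
    then show ?thesis using w2(1) by (meson rtranclp_trans)
  qed
qed

text \<open>Read a triple \<open>(t, x, u)\<close> as saying that the point \<open>x\<close> lies on
  the line indexed by \<open>t\<close>. Then \<open>join_ex\<close> gives a line through two points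
  and \<open>meet_ex\<close> a common point of two lines. Exchanging the roles of points and lines
  in \<open>join_unique\<close> also makes the common point unique.\<close>

locale triangle_presentation =
  fixes P :: "'p set" and T :: "('p \<times> 'p \<times> 'p) set"
  assumes T_subset: "T \<subseteq> P \<times> P \<times> P"
    and cyc: "(x, y, z) \<in> T \<Longrightarrow> (y, z, x) \<in> T"
    and third_unique: "(x, y, z) \<in> T \<Longrightarrow> (x, y, z') \<in> T \<Longrightarrow> z = z'"
    and join_ex: "x \<in> P \<Longrightarrow> y \<in> P \<Longrightarrow> x \<noteq> y \<Longrightarrow> \<exists>t u v. (t, x, u) \<in> T \<and> (t, y, v) \<in> T"
    and meet_ex: "x \<in> P \<Longrightarrow> y \<in> P \<Longrightarrow> x \<noteq> y \<Longrightarrow> \<exists>t u v. (x, t, u) \<in> T \<and> (y, t, v) \<in> T"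
    and join_unique: "x \<noteq> y \<Longrightarrow> (t, x, u) \<in> T \<Longrightarrow> (t, y, v) \<in> T
      \<Longrightarrow> (t', x, u') \<in> T \<Longrightarrow> (t', y, v') \<in> T \<Longrightarrow> t = t'"
begin

abbreviation weq :: "'p gword \<Rightarrow> 'p gword \<Rightarrow> bool" (infix "\<approx>" 50) where
  "u \<approx> v \<equiv> word_eq P (triella_relators T) u v"

lemma T_in: "(x, y, z) \<in> T \<Longrightarrow> x \<in> P \<and> y \<in> P \<and> z \<in> P"
  using T_subset by auto

lemma cyc2: "(x, y, z) \<in> T \<Longrightarrow> (z, x, y) \<in> T"
  using cyc by blast

lemma first_unique: "(x, y, z) \<in> T \<Longrightarrow> (x', y, z) \<in> T \<Longrightarrow> x = x'"
  using cyc third_unique by blast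

section \<open>The rewriting system and its confluence\<close>

inductive rule :: "'p \<times> bool \<Rightarrow> 'p \<times> bool \<Rightarrow> 'p gword \<Rightarrow> bool" where
  pos: "(x, y, z) \<in> T \<Longrightarrow> rule (x, True) (y, True) [(z, False)]"
| neg: "(x, y, z) \<in> T \<Longrightarrow> rule (y, False) (x, False) [(z, True)]"
| cancel: "x \<in> P \<Longrightarrow> rule (x, e) (x, \<not> e) []"
| swap: "(t, x, u) \<in> T \<Longrightarrow> (t, y, v) \<in> T \<Longrightarrow> x \<noteq> y \<Longrightarrow>
    rule (x, False) (y, True) [(u, True), (v, False)]"

inductive step :: "'p gword \<Rightarrow> 'p gword \<Rightarrow> bool" where
  head: "rule a b r \<Longrightarrow> step (a # b # w) (r @ w)"
| tail: "step w w' \<Longrightarrow> step (a # w) (a # w')"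

inductive_cases ruleE: "rule a b r"
inductive_cases stepE: "step (a # w) w'"

lemma step_Cons_cases:
  "step (a # u) v \<Longrightarrow> (\<exists>b r w. rule a b r \<and> u = b # w \<and> v = r @ w) \<or> (\<exists>u'. step u u' \<and> v = a # u')"
  by (auto elim: stepE)

text \<open>In \<open>swap\<close> the line \<open>t\<close> is the unique one through
  \<open>x\<close> and \<open>y\<close>, and the condition that \<open>x\<close> and
  \<open>y\<close> differ keeps this rule apart from \<open>cancel\<close>.\<close>

lemma rule_fun: "rule a b r \<Longrightarrow> rule a b r' \<Longrightarrow> r = r'"
  by (auto elim!: ruleE dest: third_unique join_unique)

lemma step_pos: "(x, y, z) \<in> T \<Longrightarrow> step ((x, True) # (y, True) # w) ((z, False) # w)"
  using head[OF rule.pos] by simp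

lemma step_neg: "(x, y, z) \<in> T \<Longrightarrow> step ((y, False) # (x, False) # w) ((z, True) # w)"
  using head[OF rule.neg] by simp

lemma step_cancel: "x \<in> P \<Longrightarrow> step ((x, True) # (x, False) # w) w"
   "x \<in> P \<Longrightarrow> step ((x, False) # (x, True) # w) w"
  using head[OF rule.cancel, of x True] head[OF rule.cancel, of x False] by simp_all

lemma step_swap: "(t, x, u) \<in> T \<Longrightarrow> (t, y, v) \<in> T \<Longrightarrow> x \<noteq> y \<Longrightarrow>
    step ((x, False) # (y, True) # w) ((u, True) # (v, False) # w)"
  using head[OF rule.swap] by simp

lemma steps_tail: "step\<^sup>*\<^sup>* w w' \<Longrightarrow> step\<^sup>*\<^sup>* (a # w) (a # w')"
  by (induction rule: rtranclp_induct) (auto intro: rtranclp.rtrancl_into_rtrancl tail)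

lemma step_append: "step w w' \<Longrightarrow> step (u @ w) (u @ w')"
  by (induction u) (auto intro: tail)

lemma step_append2: "step w w' \<Longrightarrow> step (w @ u) (w' @ u)"
proof (induction rule: step.induct)
  case (head a b r w)
  then show ?case using step.head[OF head, of "w @ u"] by simp
qed (auto intro: tail)

lemma steps_append: "step\<^sup>*\<^sup>* w w' \<Longrightarrow> step\<^sup>*\<^sup>* u u' \<Longrightarrow> step\<^sup>*\<^sup>* (w @ u) (w' @ u')"
proof -
  assume "step\<^sup>*\<^sup>* w w'" then have 1: "step\<^sup>*\<^sup>* (w @ u) (w' @ u)"
    by (induction rule: rtranclp_induct) (auto intro: rtranclp.rtrancl_into_rtrancl step_append2)
  assume "step\<^sup>*\<^sup>* u u'" then have 2: "step\<^sup>*\<^sup>* (w' @ u) (w' @ u')"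
    by (induction rule: rtranclp_induct) (auto intro: rtranclp.rtrancl_into_rtrancl step_append)
  show ?thesis using 1 2 by simp
qed

definition joinable :: "'p gword \<Rightarrow> 'p gword \<Rightarrow> bool" where
  "joinable u v \<longleftrightarrow> (\<exists>w. step\<^sup>*\<^sup>* u w \<and> step\<^sup>*\<^sup>* v w)"

lemma joinable_refl: "joinable u u" unfolding joinable_def by blast
lemma joinable_sym: "joinable u v \<Longrightarrow> joinable v u" unfolding joinable_def by blast
lemma joinable_step: "step u u' \<Longrightarrow> joinable u' v \<Longrightarrow> joinable u v"
  unfolding joinable_def by (meson converse_rtranclp_into_rtranclp)
lemma joinable_step2: "step v v' \<Longrightarrow> joinable u v' \<Longrightarrow> joinable u v"
  using joinable_step joinable_sym by blast

text \<open>Two rules overlap in the single letter \<open>b\<close>. Whenever a further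
  \<open>swap\<close> is needed to close the pair, the required line is the middle letter
  \<open>y\<close>, by rotating triples; if the two points of that swap coincide, a cancellation
  takes its place.\<close>

lemma critical_pair:
  assumes "rule a b r" "rule b c r'"
  shows "joinable (r @ c # w) (a # r' @ w)"
  using assms(1)
proof cases
  case (pos x y u)
  show ?thesis using assms(2)
  proof cases
    case pos': (pos y' z v)
    show ?thesis
    proof (cases "z = u")
      case True
      then have "v = x" using pos pos' cyc third_unique by blast
      then show ?thesis using pos pos' True T_in[OF pos(4)]
        by (auto intro: joinable_step[OF step_cancel(2)] joinable_step2[OF step_cancel(1)] joinable_refl)
    next
      case False
      then have "step ((u, False) # (z, True) # w) ((x, True) # (v, False) # w)"
        using pos pos' cyc[OF pos(4)] by (auto intro!: step_swap)
      then show ?thesis using pos pos' by (auto intro: joinable_step joinable_refl)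
    qed
  next
    case (cancel y' e)
    then show ?thesis using pos cyc[OF pos(4)]
      by (auto intro: joinable_step[OF step_neg] joinable_refl)
  qed (use pos in auto)
next
  case (neg y x p)
  show ?thesis using assms(2)
  proof cases
    case neg': (neg z y' s)
    have yx: "(y, x, p) \<in> T" "(y, s, z) \<in> T" using cyc[OF neg'(4)] neg neg' by simp_all
    show ?thesis
    proof (cases "x = s")
      case True
      then have "p = z" using yx third_unique by blast
      then show ?thesis using neg neg' True T_in[OF neg(4)]
        by (auto intro: joinable_step[OF step_cancel(1)] joinable_step2[OF step_cancel(2)] joinable_refl)
    next
      case False
      then show ?thesis using neg neg' step_swap[OF yx False, of w]
        by (auto intro: joinable_step2 joinable_refl)
    qed
  next
    case (cancel y' e)
    then show ?thesis using neg cyc2[OF neg(4)]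
      by (auto intro: joinable_step[OF step_pos] joinable_refl)
  next
    case (swap t y' u z v)
    have yx: "(y, x, p) \<in> T" "(y, u, t) \<in> T" using cyc[OF swap(4)] neg swap by simp_all
    show ?thesis
    proof (cases "x = u")
      case True
      then have "p = t" using yx third_unique by blast
      then show ?thesis using neg swap True T_in[OF neg(4)]
        by (auto intro: joinable_step[OF step_pos] joinable_step2[OF step_cancel(2)] joinable_refl)
    next
      case False
      have "step ((t, False) # (v, False) # w) ((z, True) # w)"
        using step_neg[OF cyc2[OF swap(5)]] swap by simp
      then have "step ((p, True) # (t, False) # (v, False) # w) ((p, True) # (z, True) # w)"
        by (rule tail)
      then have "joinable ((p, True) # (z, True) # w) ((x, False) # (u, True) # (v, False) # w)"
        using joinable_step2[OF step_swap[OF yx False, of "(v, False) # w"]] joinable_step2 joinable_refl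
        by blast
      then show ?thesis using neg swap by simp
    qed
  qed (use neg in auto)
next
  case (cancel x e)
  show ?thesis using assms(2)
  proof cases
    case (pos y z u)
    then show ?thesis using cancel cyc2[OF pos(4)]
      by (auto intro: joinable_step2[OF step_neg] joinable_refl)
  next
    case (neg y x' z)
    then show ?thesis using cancel cyc[OF neg(4)]
      by (auto intro: joinable_step2[OF step_pos] joinable_refl)
  next
    case cancel
    then show ?thesis using \<open>a = (x, e)\<close> \<open>b = (x, \<not> e)\<close> \<open>r = []\<close> by (auto intro: joinable_refl)
  next
    case (swap t x' u z v)
    have 1: "step ((x, True) # (u, True) # (v, False) # w) ((t, False) # (v, False) # w)"
      using step_pos[OF cyc2[OF cyc2[OF swap(4)]]] swap cancel by simp
    have 2: "step ((t, False) # (v, False) # w) ((z, True) # w)"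
      using step_neg[OF cyc2[OF swap(5)]] swap by simp
    have "joinable ((z, True) # w) ((x, True) # (u, True) # (v, False) # w)"
      by (rule joinable_step2[OF 1 joinable_step2[OF 2 joinable_refl]])
    then show ?thesis using swap cancel by simp
  qed
next
  case (swap t x u y v)
  show ?thesis using assms(2)
  proof cases
    case (pos y' z s)
    have yz: "(y, v, t) \<in> T" "(y, z, s) \<in> T" using cyc[OF swap(5)] swap pos by simp_all
    show ?thesis
    proof (cases "v = z")
      case True
      then have "s = t" using yz third_unique by blast
      then show ?thesis using swap pos True T_in[OF pos(4)] 
        by (auto intro: joinable_step2[OF step_neg] joinable_step[OF tail[OF step_cancel(2)]] joinable_refl)
    next
      case False
      have "step ((u, True) # (v, False) # (z, True) # w) ((u, True) # (t, True) # (s, False) # w)"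
        by (intro tail step_swap[OF yz False])
      moreover have "step ((u, True) # (t, True) # (s, False) # w) ((x, False) # (s, False) # w)"
        using step_pos[OF cyc2[OF swap(4)]] step_pos[OF cyc[OF cyc[OF swap(4)]]] step_pos[OF cyc[OF swap(4)]] swap by simp
      ultimately have "joinable ((u, True) # (v, False) # (z, True) # w) ((x, False) # (s, False) # w)"
        by (blast intro: joinable_step joinable_refl)
      then show ?thesis using swap pos by simp
    qed
  next
    case (cancel y' e)
    have "step ((u, True) # (v, False) # (y, False) # w) ((u, True) # (t, True) # w)"
      using step_neg[OF cyc[OF swap(5)]] swap by (auto intro: tail)
    moreover have "step ((u, True) # (t, True) # w) ((x, False) # w)"
      using step_pos[OF cyc[OF cyc[OF swap(4)]]] step_pos[OF cyc[OF swap(4)]] swap by simp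
    ultimately have "joinable ((u, True) # (v, False) # (y, False) # w) ((x, False) # w)"
      by (blast intro: joinable_step joinable_refl)
    then show ?thesis using swap cancel by simp
  qed (use swap in auto)
qed

text \<open>Two redexes at the head coincide, overlap in one letter, or are disjoint and commute;
  two steps in the tail are covered by induction on the word.\<close>

lemma local_confluence: "step u v \<Longrightarrow> step u v' \<Longrightarrow> joinable v v'"
proof (induction u arbitrary: v v')
  case Nil
  then show ?case by (auto elim: step.cases)
next
  case (Cons a u)
  have *: "joinable v v'" if h: "rule a b r" "u = b # w" "v = r @ w" "step (a # u) v'" for b r w v v'
    using step_Cons_cases[OF h(4)]
  proof (elim disjE exE conjE)
    fix b' r' w' assume "rule a b' r'" "u = b' # w'" "v' = r' @ w'"
    moreover have "r' = r" using calculation h rule_fun[OF h(1)] by simp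
    ultimately show ?thesis using h by (auto intro: joinable_refl)
  next
    fix u' assume 2: "step u u'" "v' = a # u'"
    have "step (b # w) u'" using 2 h by simp
    from step_Cons_cases[OF this] show ?thesis
    proof (elim disjE exE conjE)
      fix c r' w' assume "rule b c r'" "w = c # w'" "u' = r' @ w'"
      then show ?thesis using critical_pair[OF h(1)] h(3) 2 by simp
    next
      fix w' assume 3: "step w w'" "u' = b # w'"
      have "step (r @ w) (r @ w')" using 3 by (auto intro: step_append)
      moreover have "step v' (r @ w')" using 2 3 h(1) by (auto intro: head)
      ultimately show ?thesis using h(3) joinable_step joinable_step2 joinable_refl by blast
    qed
  qed
  show ?case using step_Cons_cases[OF Cons.prems(1)] step_Cons_cases[OF Cons.prems(2)]
  proof (elim disjE exE conjE)
    fix w w' assume 2: "step u w" "v = a # w" "step u w'" "v' = a # w'"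
    then obtain z where "step\<^sup>*\<^sup>* w z" "step\<^sup>*\<^sup>* w' z" using Cons.IH joinable_def by blast
    then show ?thesis using 2 steps_tail joinable_def by blast
  qed (use * Cons.prems joinable_sym in blast)+
qed

text \<open>Words are read as base-3 numerals with digits 1 (generator) and 2 (inverse generator); every rule
  decreases the value, and never lengthens the word.\<close>

fun weight :: "'p gword \<Rightarrow> nat" where
  "weight [] = 0"
| "weight ((x, e) # w) = (if e then 1 else 2) * 3 ^ length w + weight w"

definition letter_counts :: "'p gword \<Rightarrow> nat \<times> nat" where
  "letter_counts u = (length (filter snd u), length (filter (\<lambda>a. \<not> snd a) u))"

lemma letter_counts_append: "letter_counts (u @ v) = letter_counts u + letter_counts v"
  by (simp add: letter_counts_def)

lemma length_letter_counts: "length u = fst (letter_counts u) + snd (letter_counts u)"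
  by (simp add: letter_counts_def sum_length_filter_compl)

lemma step_length: "step u v \<Longrightarrow> length v < length u \<or> letter_counts v = letter_counts u"
proof (induction rule: step.induct)
  case (head a b r w)
  then show ?case by (auto elim!: ruleE simp: letter_counts_def)
next
  case (tail w w' a)
  then show ?case by (auto simp: letter_counts_def)
qed

lemma step_weight: "step u v \<Longrightarrow> weight v < weight u"
proof (induction rule: step.induct)
  case (head a b r w)
  then show ?case by (cases a, cases b) (auto elim!: ruleE)
next
  case (tail w w' a)
  \<comment> \<open>The place value of the head digit is determined by the length of the tail, so
    the tail must not grow.\<close>
  have "length w' \<le> length w" using step_length[OF tail(1)] by (auto simp: length_letter_counts)
  then have "(3::nat) ^ length w' \<le> 3 ^ length w" by simp
  then show ?case using tail(2) by (cases a) (auto intro: add_le_less_mono mult_le_mono)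
qed

lemma wf_step: "wfp (\<lambda>v u. step u v)"
  by (rule wfp_if_convertible_to_nat[of _ weight]) (rule step_weight)

lemma confluence: "step\<^sup>*\<^sup>* x y \<Longrightarrow> step\<^sup>*\<^sup>* x z \<Longrightarrow> joinable y z"
  using newman[OF wf_step] local_confluence unfolding joinable_def by blast

lemma joinable_trans: "joinable u v \<Longrightarrow> joinable v w \<Longrightarrow> joinable u w"
  using confluence unfolding joinable_def by (meson rtranclp_trans)

text \<open>The Church-Rosser property. Confluence makes joinability transitive, and it is
  compatible with concatenation, so it contains the whole congruence generated by cancellation and
  the relators.\<close>

lemma weq_joinable: "u \<approx> v \<Longrightarrow> joinable u v"
proof (induction rule: word_eq.induct)
  case (app u u' v v')
  then show ?case unfolding joinable_def using steps_append by blast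
next
  case (cancel x e)
  then show ?case using head[OF rule.cancel[OF cancel], of e "[]"]
    by (auto intro: joinable_step joinable_refl)
next
  case (relator u)
  then obtain x y z where xyz: "(x, y, z) \<in> T" "u = [(x, True), (y, True), (z, True)]"
    by (auto simp: triella_relators_def)
  have "step [(z, False), (z, True)] []" using T_in[OF xyz(1)] by (auto intro: step_cancel)
  then have "joinable [(x, True), (y, True), (z, True)] []"
    using joinable_step[OF step_pos[OF xyz(1)]] joinable_step joinable_refl by blast
  then show ?case using xyz(2) by simp
qed (auto intro: joinable_refl joinable_sym joinable_trans)

section \<open>Soundness of rewriting in the presented group\<close>

lemma gwords_simps [simp]: "[] \<in> gwords P" "a # u \<in> gwords P \<longleftrightarrow> fst a \<in> P \<and> u \<in> gwords P"
  "u @ v \<in> gwords P \<longleftrightarrow> u \<in> gwords P \<and> v \<in> gwords P"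
  by (auto simp: gwords_def mem_Times_iff)

lemma weq_refl: "u \<in> gwords P \<Longrightarrow> u \<approx> u" by (rule word_eq.refl)

lemma weq_cong: "u \<approx> v \<Longrightarrow> a \<in> gwords P \<Longrightarrow> b \<in> gwords P \<Longrightarrow> a @ u @ b \<approx> a @ v @ b"
  by (intro word_eq.app weq_refl)

lemmas weq_trans [trans] = word_eq.trans[of P "triella_relators T"]
lemmas weq_sym = word_eq.sym[of P "triella_relators T"]

lemma relator_weq: "(x, y, z) \<in> T \<Longrightarrow> [(x, True), (y, True), (z, True)] \<approx> []"
  using T_in by (auto intro!: word_eq.relator simp: triella_relators_def)

text \<open>Multiplication by an inverse letter on the left; it serves to solve relators for their
  letters.\<close>

lemma weq_cancel_left:
  assumes "x \<in> P" "(x, e) # u \<approx> v"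
  shows "u \<approx> (x, \<not> e) # v"
proof -
  have g: "u \<in> gwords P" "v \<in> gwords P" using word_eq_gwords[OF assms(2)] by auto
  have "[(x, \<not> e), (x, \<not> \<not> e)] @ u \<approx> [] @ u"
    using assms(1) g by (intro word_eq.app word_eq.cancel weq_refl) auto
  then have 1: "u \<approx> [(x, \<not> e), (x, e)] @ u" using weq_sym by simp
  also have "\<dots> \<approx> [(x, \<not> e)] @ v" using weq_cong[OF assms(2), of "[(x, \<not> e)]" "[]"] assms(1) by simp
  finally show ?thesis by simp
qed

lemma rule_weq: "rule a b r \<Longrightarrow> [a, b] \<approx> r"
proof (induction rule: rule.induct)
  case (pos x y z)
  show ?case using weq_cancel_left[OF _ relator_weq[OF cyc2[OF pos]]] T_in[OF pos] by simp
next
  case (neg x y z)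
  have "[(y, True), (z, True)] \<approx> [(x, False)]"
    using weq_cancel_left[OF _ relator_weq[OF neg]] T_in[OF neg] by simp
  then show ?case using weq_cancel_left[THEN weq_sym, of y True] T_in[OF neg] by simp
next
  case (cancel x e)
  then show ?case by (rule word_eq.cancel)
next
  case (swap t x u y v)
  have P: "t \<in> P" "x \<in> P" "u \<in> P" "y \<in> P" using T_in swap by blast+
  \<comment> \<open>The letter of the common line is inserted: \<open>a_x^-1 = a_u a_t\<close> and
    \<open>a_t a_y = a_v^-1\<close>.\<close>
  have 1: "[(u, True), (t, True)] \<approx> [(x, False)]"
    using weq_cancel_left[OF _ relator_weq[OF cyc[OF swap(1)]]] P by simp
  have 2: "[(t, True), (y, True)] \<approx> [(v, False)]"
    using weq_cancel_left[OF _ relator_weq[OF cyc2[OF swap(2)]]] T_in[OF swap(2)] by simp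
  have "[(x, False), (y, True)] \<approx> [(u, True), (t, True), (y, True)]"
    using weq_cong[OF 1[THEN weq_sym], of "[]" "[(y, True)]"] P by simp
  also have "\<dots> \<approx> [(u, True), (v, False)]"
    using weq_cong[OF 2, of "[(u, True)]" "[]"] P by simp
  finally show ?case .
qed

lemma step_weq: "step u v \<Longrightarrow> u \<in> gwords P \<Longrightarrow> u \<approx> v"
proof (induction rule: step.induct)
  case (head a b r w)
  then show ?case using weq_cong[OF rule_weq[OF head(1)], of "[]" w] by simp
next
  case (tail w w' a)
  then show ?case using weq_cong[of w w' "[a]" "[]"] by simp
qed

lemma steps_weq: "step\<^sup>*\<^sup>* u v \<Longrightarrow> u \<in> gwords P \<Longrightarrow> u \<approx> v"
  by (induction rule: rtranclp_induct) (use weq_refl weq_trans step_weq word_eq_gwords in blast)+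

lemma steps_length: "step\<^sup>*\<^sup>* u v \<Longrightarrow> length v < length u \<or> letter_counts v = letter_counts u"
proof (induction rule: rtranclp_induct)
  case (step v w)
  then show ?case using step_length[OF step(2)] length_letter_counts[of u] length_letter_counts[of v] length_letter_counts[of w]
    by auto
qed simp

section \<open>Reduced words and normal forms\<close>

definition pnword :: "'p list \<Rightarrow> 'p list \<Rightarrow> 'p gword" where
  "pnword xs ys = map (\<lambda>x. (x, True)) xs @ map (\<lambda>y. (y, False)) ys"

definition pos_reduced :: "'p list \<Rightarrow> bool" where
  "pos_reduced xs \<longleftrightarrow> set xs \<subseteq> P \<and> successively (\<lambda>x x'. \<nexists>z. (x, x', z) \<in> T) xs"

text \<open>The entries of the triple appear in reversed order because \<open>a_y^-1 a_y'^-1\<close>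
  is the inverse of \<open>a_y' a_y\<close>.\<close>

definition neg_reduced :: "'p list \<Rightarrow> bool" where
  "neg_reduced ys \<longleftrightarrow> set ys \<subseteq> P \<and> successively (\<lambda>y y'. \<nexists>z. (y', y, z) \<in> T) ys"

definition reduced :: "'p list \<Rightarrow> 'p list \<Rightarrow> bool" where
  "reduced xs ys \<longleftrightarrow> pos_reduced xs \<and> neg_reduced ys \<and> (xs \<noteq> [] \<and> ys \<noteq> [] \<longrightarrow> last xs \<noteq> hd ys)"

lemmas reduced_defs = reduced_def pos_reduced_def neg_reduced_def

lemma pnword_simps:
  "pnword [] [] = []"
  "pnword (x # xs) ys = (x, True) # pnword xs ys"
  "pnword [] (y # ys) = (y, False) # pnword [] ys"
  by (simp_all add: pnword_def)

lemma length_pnword [simp]: "length (pnword xs ys) = length xs + length ys"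
  by (simp add: pnword_def)

lemma letter_counts_pnword [simp]: "letter_counts (pnword xs ys) = (length xs, length ys)"
  by (simp add: letter_counts_def pnword_def filter_map o_def)

text \<open>The only rule that preserves length is \<open>swap\<close>, and it needs a negative
  letter directly before a positive one.\<close>

lemma step_pnword_shorter:
  "step (pnword xs ys) v \<Longrightarrow> length v < length xs + length ys"
proof (induction xs arbitrary: v)
  case Nil
  then show ?case
  proof (induction ys arbitrary: v)
    case Nil
    then show ?case by (auto simp: pnword_simps elim: step.cases)
  next
    case (Cons y ys)
    then show ?case using step_Cons_cases[of "(y, False)" "pnword [] ys" v]
      by (cases ys) (auto simp: pnword_simps elim!: ruleE)
  qed
next
  case (Cons x xs)
  from Cons.prems have "step ((x, True) # pnword xs ys) v" by (simp add: pnword_simps)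
  from step_Cons_cases[OF this] show ?case
  proof (elim disjE exE conjE)
    fix b r w assume h: "rule (x, True) b r" "pnword xs ys = b # w" "v = r @ w"
    have "length xs + length ys = Suc (length w)" using arg_cong[OF h(2), of length] by simp
    then show ?thesis using h by (auto elim!: ruleE)
  qed (use Cons.IH in auto)
qed

lemma reduced_neg_irreducible: "reduced [] ys \<Longrightarrow> \<not> step (pnword [] ys) u"
proof (induction ys arbitrary: u)
  case Nil
  then show ?case by (auto simp: pnword_simps elim: step.cases)
next
  case (Cons y ys)
  have ys: "reduced [] ys" using Cons.prems by (auto simp: reduced_defs successively_Cons)
  show ?case
  proof
    assume "step (pnword [] (y # ys)) u"
    then have "step ((y, False) # pnword [] ys) u" by (simp add: pnword_simps)
    then obtain b r w where "rule (y, False) b r" "pnword [] ys = b # w"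
      using step_Cons_cases Cons.IH[OF ys] by blast
    then show False using Cons.prems
      by (cases ys) (auto simp: pnword_simps reduced_defs elim!: ruleE)
  qed
qed

lemma reduced_irreducible: "reduced xs ys \<Longrightarrow> \<not> step (pnword xs ys) u"
proof (induction xs arbitrary: u)
  case Nil
  then show ?case using reduced_neg_irreducible by simp
next
  case (Cons x xs)
  have xs: "reduced xs ys" using Cons.prems by (auto simp: reduced_defs successively_Cons)
  show ?case
  proof
    assume "step (pnword (x # xs) ys) u"
    then have "step ((x, True) # pnword xs ys) u" by (simp add: pnword_simps)
    then obtain b r w where "rule (x, True) b r" "pnword xs ys = b # w"
      using step_Cons_cases Cons.IH[OF xs] by blast
    then show False using Cons.prems
      by (cases xs; cases ys) (auto simp: pnword_simps reduced_defs elim!: ruleE)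
  qed
qed

text \<open>A negative letter followed by a positive one is always reducible: equal points cancel,
  and for distinct points \<open>join_ex\<close> supplies a \<open>swap\<close>. Hence all positive
  letters of an irreducible word come first.\<close>

lemma irreducible_reduced:
  assumes "u \<in> gwords P" "\<And>v. \<not> step u v"
  shows "\<exists>xs ys. reduced xs ys \<and> u = pnword xs ys"
  using assms
proof (induction u)
  case Nil
  have "reduced [] [] \<and> [] = pnword [] []" by (simp add: reduced_defs pnword_def)
  then show ?case by blast
next
  case (Cons a u)
  obtain x e where a: "a = (x, e)" by (cases a)
  have x: "x \<in> P" "u \<in> gwords P" using Cons.prems a by auto
  have "\<not> step u v" for v using Cons.prems tail by blast
  then obtain xs ys where u: "reduced xs ys" "u = pnword xs ys" using Cons x by blast
  show ?case
  proof (cases e)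
    case True
    have 1: "(x, x', z) \<notin> T" if "xs = x' # xs'" for x' xs' z
      using Cons.prems(2) step_pos[of x x' z] u a True that by (auto simp: pnword_def)
    have 2: "x \<noteq> y" if "xs = []" "ys = y # ys'" for y ys'
      using Cons.prems(2) step_cancel(1)[OF x(1)] u a True that by (auto simp: pnword_def)
    have "reduced (x # xs) ys" using u(1) x 1 2
      by (cases xs; cases ys) (auto simp: reduced_defs successively_Cons)
    moreover have "a # u = pnword (x # xs) ys" using u a True by (simp add: pnword_def)
    ultimately show ?thesis by blast
  next
    case False
    have xs: "xs = []"
    proof (rule ccontr)
      assume "xs \<noteq> []"
      then obtain x' xs' where xs: "xs = x' # xs'" by (cases xs) auto
      then have "x' \<in> P" using u(1) by (auto simp: reduced_defs)
      then show False
        using Cons.prems(2) step_cancel(2)[OF x(1)] step_swap[of _ x _ x'] join_ex[OF x(1), of x']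
          u a False xs by (cases "x = x'") (fastforce simp: pnword_def)+
    qed
    have 1: "(y, x, z) \<notin> T" if "ys = y # ys'" for y ys' z
      using Cons.prems(2) step_neg[of y x z] u a False xs that by (auto simp: pnword_def)
    have "reduced [] (x # ys)" using u(1) x 1 xs
      by (cases ys) (auto simp: reduced_defs successively_Cons)
    moreover have "a # u = pnword [] (x # ys)" using u a False xs by (simp add: pnword_def)
    ultimately show ?thesis by blast
  qed
qed

lemma normal_form_ex:
  assumes "u \<in> gwords P"
  shows "\<exists>xs ys. reduced xs ys \<and> u \<approx> pnword xs ys \<and>
    (length xs + length ys < length u \<or> (length xs, length ys) = letter_counts u)"
proof -
  obtain v where v: "step\<^sup>*\<^sup>* u v" "\<And>w. \<not> step v w"
    using ex_terminating_rtranclp[of step u] wf_step by (auto simp: conversep_iff[abs_def])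
  have "u \<approx> v" using steps_weq v assms by blast
  then obtain xs ys where xy: "reduced xs ys" "v = pnword xs ys"
    using irreducible_reduced word_eq_gwords v(2) by blast
  then show ?thesis using steps_length[OF v(1)] \<open>u \<approx> v\<close> xy by auto
qed

lemma pnword_inject: "pnword xs ys = pnword xs' ys' \<longleftrightarrow> xs = xs' \<and> ys = ys'"
  by (induction xs arbitrary: xs'; induction ys arbitrary: ys'; case_tac xs'; case_tac ys')
    (auto simp: pnword_simps)

text \<open>Words for the same element are joinable, and joinable irreducible words
  coincide.\<close>

lemma normal_form_unique:
  assumes "reduced xs ys" "reduced xs' ys'" "pnword xs ys \<approx> pnword xs' ys'"
  shows "xs = xs' \<and> ys = ys'"
proof -
  obtain w where "step\<^sup>*\<^sup>* (pnword xs ys) w" "step\<^sup>*\<^sup>* (pnword xs' ys') w"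
    using weq_joinable[OF assms(3)] joinable_def by blast
  then have "pnword xs ys = pnword xs' ys'"
    using reduced_irreducible assms by (metis converse_rtranclpE)
  then show ?thesis by (simp add: pnword_inject)
qed

section \<open>Geodesic words\<close>

text \<open>These are the geodesics from the identity in the Cayley graph. The notion refers to
  neither order of signs, so the two normal forms can be compared through it.\<close>

definition geodesic :: "'p gword \<Rightarrow> bool" where
  "geodesic u \<longleftrightarrow> u \<in> gwords P \<and> (\<forall>v. u \<approx> v \<longrightarrow> length u \<le> length v)"

lemma reduced_gwords: "reduced xs ys \<Longrightarrow> pnword xs ys \<in> gwords P"
  by (auto simp: reduced_defs pnword_def gwords_def)

text \<open>Any equivalent word rewrites to the same normal form, and rewriting never lengthens a
  word.\<close>

lemma reduced_imp_geodesic: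
  assumes "reduced xs ys"
  shows "geodesic (pnword xs ys)"
  unfolding geodesic_def
proof (intro conjI allI impI)
  fix v assume v: "pnword xs ys \<approx> v"
  obtain xs' ys' where n: "reduced xs' ys'" "v \<approx> pnword xs' ys'" "length xs' + length ys' \<le> length v"
    using normal_form_ex[of v] v word_eq_gwords length_letter_counts[of v] by (metis fst_conv less_imp_le order_refl snd_conv)
  then have "xs = xs' \<and> ys = ys'" using normal_form_unique assms v weq_trans by blast
  then show "length (pnword xs ys) \<le> length v" using n(3) by simp
qed (use assms reduced_gwords in blast)

text \<open>Rewriting cannot shorten a geodesic, and a reduction that does not shorten keeps the
  letter counts.\<close>

lemma geodesic_normal_form:
  assumes "geodesic u"
  obtains xs ys where "reduced xs ys" "u \<approx> pnword xs ys" "letter_counts u = (length xs, length ys)"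
proof -
  obtain xs ys where n: "reduced xs ys" "u \<approx> pnword xs ys"
    "length xs + length ys < length u \<or> (length xs, length ys) = letter_counts u"
    using normal_form_ex assms geodesic_def by blast
  then have "length u \<le> length xs + length ys" using assms geodesic_def by force
  then show ?thesis using n that by auto
qed

text \<open>Any rewriting step on a word with its positive letters first would produce a strictly
  shorter equivalent word.\<close>

lemma geodesic_imp_reduced:
  assumes "geodesic (pnword xs ys)"
  shows "reduced xs ys"
proof -
  have "\<not> step (pnword xs ys) v" for v
    using step_pnword_shorter[of xs ys v] step_weq assms unfolding geodesic_def by fastforce
  then show ?thesis
    using irreducible_reduced[of "pnword xs ys"] assms unfolding geodesic_def pnword_inject by blast
qed

definition npword :: "'p list \<Rightarrow> 'p list \<Rightarrow> 'p gword" where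
  "npword ys xs = map (\<lambda>y. (y, False)) ys @ map (\<lambda>x. (x, True)) xs"

end

section \<open>Duality between generators and inverses\<close>

text \<open>Inverting \<open>a_x a_y a_z = 1\<close> gives \<open>a_z^-1 a_y^-1 a_x^-1 = 1\<close>,
  so the inverse generators satisfy the relations of the reversed triples.\<close>

definition rev_triples :: "('p \<times> 'p \<times> 'p) set \<Rightarrow> ('p \<times> 'p \<times> 'p) set" where
  "rev_triples T = {(x, y, z). (z, y, x) \<in> T}"

text \<open>In contrast to \<open>gword_inv\<close> the order of the letters is kept, so this
  induces an isomorphism onto the dual group rather than inversion.\<close>

definition flip :: "'p gword \<Rightarrow> 'p gword" where
  "flip u = map (\<lambda>(x, e). (x, \<not> e)) u"

lemma rev_triples_mem [simp]: "(x, y, z) \<in> rev_triples T \<longleftrightarrow> (z, y, x) \<in> T"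
  by (simp add: rev_triples_def)

lemma rev_rev_triples [simp]: "rev_triples (rev_triples T) = T"
  by (auto simp: rev_triples_def)

lemma flip_flip [simp]: "flip (flip u) = u"
  by (induction u) (auto simp: flip_def)

lemma length_flip [simp]: "length (flip u) = length u"
  by (simp add: flip_def)

lemma flip_gwords [simp]: "flip u \<in> gwords P \<longleftrightarrow> u \<in> gwords P"
  by (force simp: flip_def gwords_def)

context triangle_presentation
begin

lemma dual: "triangle_presentation P (rev_triples T)"
proof
  show "rev_triples T \<subseteq> P \<times> P \<times> P" using T_in by (auto simp: rev_triples_def)
  show "(y, z, x) \<in> rev_triples T" if "(x, y, z) \<in> rev_triples T" for x y z
    using that cyc2 by simp
  show "z = z'" if "(x, y, z) \<in> rev_triples T" "(x, y, z') \<in> rev_triples T" for x y z z'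
    using that first_unique by simp
  show "\<exists>t u v. (t, x, u) \<in> rev_triples T \<and> (t, y, v) \<in> rev_triples T"
    if "x \<in> P" "y \<in> P" "x \<noteq> y" for x y
    using meet_ex[OF that] by (meson cyc2 rev_triples_mem)
  show "\<exists>t u v. (x, t, u) \<in> rev_triples T \<and> (y, t, v) \<in> rev_triples T"
    if "x \<in> P" "y \<in> P" "x \<noteq> y" for x y
    using join_ex[OF that] by (meson cyc rev_triples_mem)
  \<comment> \<open>Points and lines exchange roles: were \<open>t\<close> and \<open>t'\<close>
    distinct, the lines \<open>x\<close> and \<open>y\<close> would both join them, and
    \<open>join_unique\<close> would force \<open>x = y\<close>.\<close>
  show "t = t'" if "x \<noteq> y" "(t, x, u) \<in> rev_triples T" "(t, y, v) \<in> rev_triples T"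
    "(t', x, u') \<in> rev_triples T" "(t', y, v') \<in> rev_triples T" for x y t t' u u' v v'
    using join_unique[of t t' x u u' y v v'] that
    by (metis cyc rev_triples_mem)
qed

interpretation dual: triangle_presentation P "rev_triples T"
  by (rule dual)

lemma weq_flip: "u \<approx> v \<Longrightarrow> word_eq P (triella_relators (rev_triples T)) (flip u) (flip v)"
proof (induction rule: word_eq.induct)
  case (app u u' v v')
  then show ?case using word_eq.app by (fastforce simp: flip_def)
next
  case (cancel x e)
  then show ?case using word_eq.cancel[of x P _ "\<not> e"] by (simp add: flip_def)
next
  case (relator u)
  then obtain x y z where xyz: "(x, y, z) \<in> T" "u = [(x, True), (y, True), (z, True)]"
    by (auto simp: triella_relators_def)
  have "dual.weq [(y, False), (z, False)] [(x, True)]"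
    using xyz by (intro dual.rule_weq dual.rule.neg) simp
  then have "dual.weq ((x, False) # [(y, False), (z, False)]) []"
    using dual.weq_cancel_left dual.weq_sym T_in[OF xyz(1)] by (metis (full_types))
  then show ?case using xyz by (simp add: flip_def)
qed (auto intro: word_eq.intros)

lemma dual_weq_iff: "dual.weq (flip u) (flip v) \<longleftrightarrow> u \<approx> v"
  using weq_flip triangle_presentation.weq_flip[OF dual, of "flip u" "flip v"] by auto

lemma dual_geodesic_iff: "dual.geodesic (flip u) \<longleftrightarrow> geodesic u"
  unfolding geodesic_def dual.geodesic_def by (metis dual_weq_iff flip_flip flip_gwords length_flip)

lemma flip_pnword [simp]: "flip (pnword xs ys) = npword xs ys"
  and flip_npword [simp]: "flip (npword ys xs) = pnword ys xs"
  by (simp_all add: flip_def pnword_def npword_def)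

text \<open>After rotating triples, the adjacency conditions of the dual system are the original
  ones with the two signs exchanged.\<close>

lemma dual_reduced_iff:
  "dual.reduced ys xs \<longleftrightarrow> neg_reduced ys \<and> pos_reduced xs \<and> (ys \<noteq> [] \<and> xs \<noteq> [] \<longrightarrow> last ys \<noteq> hd xs)"
proof -
  have "(\<forall>z. (z, x', x) \<notin> T) \<longleftrightarrow> (\<forall>z. (x', x, z) \<notin> T)"
    "(\<forall>z. (z, x', x) \<notin> T) \<longleftrightarrow> (\<forall>z. (x', x, z) \<notin> T)" for x x'
    using cyc cyc2 by blast+
  then show ?thesis by (simp add: dual.reduced_defs reduced_defs)
qed

text \<open>This makes being geodesic a condition on adjacent letters for words with negative
  letters first; \<open>glue_normal\<close> uses it to extend words.\<close>

lemma npword_geodesic_iff: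
  "geodesic (npword ys xs) \<longleftrightarrow> neg_reduced ys \<and> pos_reduced xs \<and> (ys \<noteq> [] \<and> xs \<noteq> [] \<longrightarrow> last ys \<noteq> hd xs)"
  unfolding dual_reduced_iff[symmetric] dual_geodesic_iff[of "npword ys xs", symmetric] flip_npword
  using dual.reduced_imp_geodesic dual.geodesic_imp_reduced by blast

lemma length_npword [simp]: "length (npword ys xs) = length ys + length xs"
  by (simp add: npword_def)

lemma letter_counts_npword [simp]: "letter_counts (npword ys xs) = (length xs, length ys)"
  by (simp add: letter_counts_def npword_def filter_map o_def)

text \<open>Flip, take the normal form in the dual system, and flip back; flipping interchanges the
  two letter counts.\<close>

lemma geodesic_np_form:
  assumes "geodesic u"
  obtains ys xs where "geodesic (npword ys xs)" "u \<approx> npword ys xs" "letter_counts u = (length xs, length ys)"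
proof -
  obtain ys xs where n: "dual.reduced ys xs" "dual.weq (flip u) (pnword ys xs)"
    "letter_counts (flip u) = (length ys, length xs)"
    using dual.geodesic_normal_form assms dual_geodesic_iff by metis
  have "geodesic (npword ys xs)" using n(1) dual_reduced_iff npword_geodesic_iff by blast
  moreover have "u \<approx> npword ys xs" using n(2) dual_weq_iff[of u "npword ys xs"] by simp
  moreover have "letter_counts (flip u) = (snd (letter_counts u), fst (letter_counts u))"
    by (simp add: letter_counts_def flip_def filter_map o_def case_prod_unfold)
  ultimately show ?thesis using that n(3) by (metis prod.collapse prod.inject)
qed

lemma npword_unique:
  assumes "geodesic (npword ys xs)" "geodesic (npword ys' xs')" "npword ys xs \<approx> npword ys' xs'"
  shows "ys = ys' \<and> xs = xs'"
  using dual.normal_form_unique[of ys xs ys' xs'] assms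
  by (metis dual.geodesic_imp_reduced dual_geodesic_iff dual_weq_iff flip_npword)

text \<open>A shorter word for a factor would shorten the whole word.\<close>

lemma geodesic_append:
  assumes "geodesic (u @ v)"
  shows "geodesic u" "geodesic v"
proof -
  have g: "u \<in> gwords P" "v \<in> gwords P" using assms by (auto simp: geodesic_def)
  have "length u \<le> length w" if "u \<approx> w" for w
    using weq_cong[OF that, of "[]" v] assms g unfolding geodesic_def by force
  then show "geodesic u" using g by (simp add: geodesic_def)
  have "length v \<le> length w" if "v \<approx> w" for w
    using weq_cong[OF that, of u "[]"] assms g unfolding geodesic_def by force
  then show "geodesic v" using g by (simp add: geodesic_def)
qed

lemma geodesic_weq: "geodesic u \<Longrightarrow> u \<approx> v \<Longrightarrow> length v \<le> length u \<Longrightarrow> geodesic v"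
  unfolding geodesic_def using weq_trans word_eq_gwords by (meson le_trans)

text \<open>The tool for exchanging the two normal forms of a factor inside a longer geodesic: equal
  letter counts give equal lengths.\<close>

lemma geodesic_replace:
  assumes "geodesic (a @ u @ b)" "u \<approx> u'" "letter_counts u' = letter_counts u"
  shows "geodesic (a @ u' @ b)" "a @ u @ b \<approx> a @ u' @ b"
proof -
  show 1: "a @ u @ b \<approx> a @ u' @ b" using assms by (intro weq_cong) (auto simp: geodesic_def)
  show "geodesic (a @ u' @ b)" using assms by (intro geodesic_weq[OF assms(1) 1]) (simp add: length_letter_counts letter_counts_append)
qed

lemma geodesic_ex: "u \<in> gwords P \<Longrightarrow> \<exists>v. geodesic v \<and> u \<approx> v \<and> (length v < length u \<or> letter_counts v = letter_counts u)"
  using normal_form_ex[of u] reduced_imp_geodesic letter_counts_pnword length_pnword by metis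

end

section \<open>Gluing and factorising geodesics\<close>

context triangle_presentation
begin

text \<open>The conditions concern consecutive letters only, so an overlap in one letter suffices to
  join two lists.\<close>

lemma pos_reduced_overlap: "pos_reduced (xs @ [x]) \<Longrightarrow> pos_reduced (x # ys) \<Longrightarrow> pos_reduced (xs @ x # ys)"
  by (auto simp: pos_reduced_def successively_append_iff successively_Cons)

lemma neg_reduced_overlap: "neg_reduced (xs @ [x]) \<Longrightarrow> neg_reduced (x # ys) \<Longrightarrow> neg_reduced (xs @ x # ys)"
  by (auto simp: neg_reduced_def successively_append_iff successively_Cons)

lemma pnword_single: "pnword [x] [y] = [(x, True), (y, False)]" "pnword [x] [] = [(x, True)]"
  "pnword [] [y] = [(y, False)]" "npword [y] [] = [(y, False)]" "npword [] [x] = [(x, True)]"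
  by (simp_all add: pnword_def npword_def)

lemma pnword_append: "pnword xs [] @ pnword xs' ys = pnword (xs @ xs') ys"
  "pnword xs ys @ pnword [] ys' = pnword xs (ys @ ys')"
  "pnword [] ys @ pnword xs [] = npword ys xs"
  by (simp_all add: pnword_def npword_def)

text \<open>Moving \<open>a\<^sub>x\<close> to the left past \<open>cn\<close>, \<open>a\<^sub>y\<^sup>-\<^sup>1\<close> to the right past \<open>bp\<close>, and the changed lists past each other
  gives the reduced form.  The overlaps at the moved letters are controlled because
  \<open>cn a\<^sub>x bp'\<close> and \<open>cn' a\<^sub>y\<^sup>-\<^sup>1 bp\<close> are reduced for the dual system, hence geodesic.\<close>

lemma glue_normal:
  assumes "geodesic (pnword cp cn @ pnword [x] [y])" "geodesic (pnword [x] [y] @ pnword bp bn)"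
  shows "geodesic (pnword cp cn @ pnword [x] [y] @ pnword bp bn)"
proof -
  let ?p = "\<lambda>xs. pnword xs []" and ?n = "\<lambda>ys. pnword [] ys"
  have g1: "geodesic (?p cp @ (?n cn @ ?p [x]) @ ?n [y])" and g2: "geodesic (?p [x] @ (?n [y] @ ?p bp) @ ?n bn)"
    using assms by (simp_all add: pnword_def)
  have xy: "x \<noteq> y"
    using geodesic_append(2)[OF assms(1)] geodesic_imp_reduced[of "[x]" "[y]"] by (auto simp: reduced_def)
  \<comment> \<open>The first move. Letter counts are preserved, so exactly one positive letter
    \<open>x'\<close> comes out on the left.\<close>
  obtain xs cn' where c: "reduced xs cn'" "?n cn @ ?p [x] \<approx> pnword xs cn'"
    "letter_counts (?n cn @ ?p [x]) = (length xs, length cn')"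
    using geodesic_normal_form g1 geodesic_append by metis
  have "length xs = Suc 0" and lc: "length cn' = length cn"
    using c(3) by (simp_all add: letter_counts_append)
  then obtain x' where xs: "xs = [x']" by (metis length_0_conv length_Suc_conv)
  obtain bp' ys where b: "reduced bp' ys" "?n [y] @ ?p bp \<approx> pnword bp' ys"
    "letter_counts (?n [y] @ ?p bp) = (length bp', length ys)"
    using geodesic_normal_form g2 geodesic_append by metis
  have "length ys = Suc 0" and lb: "length bp' = length bp"
    using b(3) by (simp_all add: letter_counts_append)
  then obtain y' where ys: "ys = [y']" by (metis length_0_conv length_Suc_conv)
  have "geodesic (?p cp @ pnword [x'] cn' @ ?n [y])"
    using geodesic_replace(1)[OF g1, of "pnword [x'] cn'"] c xs by simp
  then have g3: "reduced (cp @ [x']) (cn' @ [y])"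
    by (intro geodesic_imp_reduced) (simp add: pnword_def)
  have "geodesic (?p [x] @ pnword bp' [y'] @ ?n bn)"
    using geodesic_replace(1)[OF g2, of "pnword bp' [y']"] b ys by simp
  then have g4: "reduced (x # bp') (y' # bn)"
    by (intro geodesic_imp_reduced) (simp add: pnword_def)
  have n1: "geodesic (npword cn [x])" and n2: "geodesic (npword [y] bp)"
    using g1 g2 geodesic_append unfolding pnword_append by metis+
  \<comment> \<open>Here \<open>n1\<close> controls \<open>cn\<close> up to its junction with
    \<open>x\<close>, and \<open>g4\<close> controls the positive letters from \<open>x\<close>
    onwards.\<close>
  have "geodesic (npword cn (x # bp'))"
    using n1 g4 unfolding npword_geodesic_iff by (auto simp: reduced_def)
  then have g5: "geodesic ((?n cn @ ?p [x]) @ ?p bp')" by (simp add: npword_def pnword_def)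
  have "geodesic ([] @ pnword [x'] cn' @ ?p bp')"
    using geodesic_replace(1)[of "[]" "?n cn @ ?p [x]" "?p bp'" "pnword [x'] cn'"] g5 c xs by simp
  then have g6: "geodesic (?p [x'] @ (?n cn' @ ?p bp') @ [])" by (simp add: pnword_def)
  have "geodesic (npword (cn' @ [y]) bp)"
    using n2 g3 unfolding npword_geodesic_iff by (auto simp: reduced_def)
  then have g7: "geodesic (?n cn' @ (?n [y] @ ?p bp) @ [])" by (simp add: npword_def pnword_def)
  have "geodesic (?n cn' @ pnword bp' [y'] @ [])"
    using geodesic_replace(1)[OF g7, of "pnword bp' [y']"] b ys by simp
  then have g8: "geodesic ([] @ (?n cn' @ ?p bp') @ ?n [y'])" by (simp add: pnword_def)
  \<comment> \<open>The last exchange takes place inside both \<open>g6\<close> and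
    \<open>g8\<close>, so its result fits after \<open>x'\<close> as well as before
    \<open>y'\<close>.\<close>
  obtain bq cq where q: "reduced bq cq" "?n cn' @ ?p bp' \<approx> pnword bq cq"
    "letter_counts (?n cn' @ ?p bp') = (length bq, length cq)"
    using geodesic_normal_form g6 geodesic_append by metis
  have lq: "length bq = length bp" "length cq = length cn"
    using q(3) lb lc by (auto simp: letter_counts_append)
  have "geodesic (?p [x'] @ pnword bq cq @ [])"
    using geodesic_replace(1)[OF g6 q(2)] q(3) by simp
  then have g9: "reduced (x' # bq) cq"
    by (intro geodesic_imp_reduced) (simp add: pnword_def)
  have "geodesic ([] @ pnword bq cq @ ?n [y'])"
    using geodesic_replace(1)[OF g8 q(2)] q(3) by simp
  then have g10: "reduced bq (cq @ [y'])"
    by (intro geodesic_imp_reduced) (simp add: pnword_def)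
  \<comment> \<open>If both exchanged lists are empty, nothing has been moved, so
    \<open>x' = x\<close> and \<open>y' = y\<close>, which differ because the middle factor is
    reduced. Otherwise \<open>g9\<close> or \<open>g10\<close> covers the junction.\<close>
  have junction: "last (x' # bq) \<noteq> hd (cq @ [y'])"
  proof (cases "bq = [] \<and> cq = []")
    case True
    then have e: "cn = []" "cn' = []" "bp = []" "bp' = []" using lq lb lc by auto
    have "pnword [x] [] \<approx> pnword [x'] []" "pnword [] [y] \<approx> pnword [] [y']"
      using c(2) b(2) e xs ys by (simp_all add: pnword_simps)
    moreover have "reduced [x] []" "reduced [x'] []" "reduced [] [y]" "reduced [] [y']"
      using g3 g4 by (auto simp: reduced_defs)
    ultimately have "x = x'" "y = y'" using normal_form_unique by blast+
    then show ?thesis using True xy by simp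
  next
    case False
    then show ?thesis using g9 g10 by (auto simp: reduced_def)
  qed
  have "reduced (cp @ x' # bq) (cq @ y' # bn)"
    using junction g3 g4 g9 g10 pos_reduced_overlap[of cp x' bq] neg_reduced_overlap[of cq y' bn]
    by (auto simp: reduced_def hd_append split: if_splits)
  then have G: "geodesic (?p cp @ ?p [x'] @ pnword bq cq @ ?n [y'] @ ?n bn)"
    by (intro back_subst[of geodesic, OF reduced_imp_geodesic]) (auto simp: pnword_def)
  have P: "pnword cp cn \<in> gwords P" "pnword bp bn \<in> gwords P" "x' \<in> P" "y' \<in> P" "x \<in> P" "y \<in> P"
    using assms g3 g4 unfolding geodesic_def
    by (auto simp: reduced_defs pnword_single)
  then have P': "?p cp \<in> gwords P" "?n cn \<in> gwords P" "?p bp \<in> gwords P" "?n bn \<in> gwords P"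
    by (simp_all add: pnword_def)
  have "?p cp @ (?n cn @ ?p [x]) @ (?n [y] @ ?p bp) @ ?n bn \<approx>
        ?p cp @ pnword [x'] cn' @ pnword bp' [y'] @ ?n bn"
    using c b xs ys P' by (intro word_eq.app weq_refl) auto
  also have "\<dots> = (?p cp @ ?p [x']) @ (?n cn' @ ?p bp') @ (?n [y'] @ ?n bn)"
    by (simp add: pnword_def)
  also have "\<dots> \<approx> (?p cp @ ?p [x']) @ pnword bq cq @ (?n [y'] @ ?n bn)"
    using P P' by (intro weq_cong q) (auto simp: pnword_single)
  finally have E: "pnword cp cn @ pnword [x] [y] @ pnword bp bn \<approx>
    ?p cp @ ?p [x'] @ pnword bq cq @ ?n [y'] @ ?n bn"
    by (simp add: pnword_def)
  show ?thesis using geodesic_weq[OF G weq_sym[OF E]] lq by simp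
qed

text \<open>Each piece is replaced by its normal form, which has the same letter counts. A middle
  piece with counts \<open>(1, 1)\<close> becomes \<open>a_x a_y^-1\<close>, the case of
  \<open>glue_normal\<close>.\<close>

lemma glue:
  assumes "geodesic (h @ s)" "geodesic (s @ k)" "letter_counts s = (1, 1)"
  shows "geodesic (h @ s @ k)"
proof -
  obtain cp cn where h: "h \<approx> pnword cp cn" "letter_counts h = (length cp, length cn)"
    using geodesic_normal_form assms geodesic_append by metis
  obtain bp bn where k: "k \<approx> pnword bp bn" "letter_counts k = (length bp, length bn)"
    using geodesic_normal_form assms geodesic_append by metis
  obtain xs ys where s: "s \<approx> pnword xs ys" "letter_counts s = (length xs, length ys)"
    using geodesic_normal_form assms geodesic_append by metis
  have "length xs = Suc 0" "length ys = Suc 0" using s(2) assms(3) by simp_all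
  then obtain x y where xy: "xs = [x]" "ys = [y]" by (metis length_0_conv length_Suc_conv)
  have hs: "h @ s \<approx> pnword cp cn @ pnword [x] [y]" using h s xy by (auto intro: word_eq.app)
  have sk: "s @ k \<approx> pnword [x] [y] @ pnword bp bn" using k s xy by (auto intro: word_eq.app)
  have hsk: "h @ s @ k \<approx> pnword cp cn @ pnword [x] [y] @ pnword bp bn"
    using h sk by (auto intro: word_eq.app)
  have "geodesic (pnword cp cn @ pnword [x] [y])"
    using geodesic_weq[OF assms(1) hs] h s xy by (simp add: length_letter_counts letter_counts_append)
  moreover have "geodesic (pnword [x] [y] @ pnword bp bn)"
    using geodesic_weq[OF assms(2) sk] k s xy by (simp add: length_letter_counts letter_counts_append)
  ultimately have "geodesic (pnword cp cn @ pnword [x] [y] @ pnword bp bn)"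
    by (rule glue_normal)
  then show ?thesis using geodesic_weq[OF _ weq_sym[OF hsk]] h s k xy by (simp add: length_letter_counts letter_counts_append)
qed

text \<open>Cut the normal form into \<open>p1 p2 q1^-1 q2^-1\<close>, with \<open>p1\<close> and
  \<open>q1\<close> of the lengths prescribed by \<open>m\<close>. Rewriting the middle
  \<open>p2 q1^-1\<close> with negative letters first, as \<open>r1^-1 r2\<close>, gives the factors
  \<open>p1 r1^-1\<close> and \<open>r2 q2^-1\<close>.\<close>

lemma factor_ex:
  assumes "geodesic w" "letter_counts w = m + n"
  shows "\<exists>h k. geodesic (h @ k) \<and> w \<approx> h @ k \<and> letter_counts h = m \<and> letter_counts k = n"
proof -
  obtain xs ys where w: "reduced xs ys" "w \<approx> pnword xs ys" "letter_counts w = (length xs, length ys)"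
    using geodesic_normal_form assms by metis
  obtain m1 m2 n1 n2 where mn: "m = (m1, m2)" "n = (n1, n2)" by (metis prod.exhaust)
  define p1 p2 where "p1 = take m1 xs" "p2 = drop m1 xs"
  define q1 q2 where "q1 = take m2 ys" "q2 = drop m2 ys"
  have len: "length p1 = m1" "length p2 = n1" "length q1 = m2" "length q2 = n2"
    using w(3) assms(2) mn by (auto simp: p1_p2_def q1_q2_def)
  have split: "pnword xs ys = pnword p1 [] @ pnword p2 q1 @ pnword [] q2"
    by (simp add: pnword_def p1_p2_def q1_q2_def flip: map_append)
  have g: "geodesic (pnword p1 [] @ pnword p2 q1 @ pnword [] q2)"
    using reduced_imp_geodesic[OF w(1)] split by simp
  then obtain r2 r1 where r: "pnword p2 q1 \<approx> npword r1 r2"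
    "letter_counts (pnword p2 q1) = (length r2, length r1)"
    using geodesic_np_form geodesic_append by metis
  note R = geodesic_replace[OF g r(1)]
  let ?h = "pnword p1 [] @ map (\<lambda>y. (y, False)) r1" and ?k = "map (\<lambda>x. (x, True)) r2 @ pnword [] q2"
  have eq: "pnword p1 [] @ npword r1 r2 @ pnword [] q2 = ?h @ ?k" by (simp add: npword_def)
  have "geodesic (?h @ ?k)" "pnword xs ys \<approx> ?h @ ?k" using R r(2) unfolding split eq by simp_all
  moreover have "letter_counts ?h = m" "letter_counts ?k = n" using len r(2) mn
    by (simp_all add: letter_counts_def pnword_def filter_map o_def)
  ultimately show ?thesis using w(2) weq_trans by blast
qed

text \<open>The construction of \<open>factor_ex\<close> is run backwards. With
  \<open>h = p q^-1\<close> and \<open>k = r s^-1\<close>, rewriting \<open>q^-1 r\<close> as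
  \<open>a b^-1\<close> yields the normal form of the product. By lengths it determines
  \<open>p\<close>, \<open>a\<close>, \<open>b\<close> and \<open>s\<close>; uniqueness of the form
  with negative letters first then recovers \<open>q\<close> and \<open>r\<close>.\<close>

lemma factor_unique:
  assumes "geodesic (h @ k)" "geodesic (h' @ k')" "h @ k \<approx> h' @ k'" "letter_counts h = letter_counts h'" "letter_counts k = letter_counts k'"
  shows "h \<approx> h' \<and> k \<approx> k'"
proof -
  obtain p q where h: "reduced p q" "h \<approx> pnword p q" "letter_counts h = (length p, length q)"
    using geodesic_normal_form assms geodesic_append by metis
  obtain p' q' where h': "reduced p' q'" "h' \<approx> pnword p' q'" "letter_counts h' = (length p', length q')"
    using geodesic_normal_form assms geodesic_append by metis
  obtain r s where k: "reduced r s" "k \<approx> pnword r s" "letter_counts k = (length r, length s)"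
    using geodesic_normal_form assms geodesic_append by metis
  obtain r' s' where k': "reduced r' s'" "k' \<approx> pnword r' s'" "letter_counts k' = (length r', length s')"
    using geodesic_normal_form assms geodesic_append by metis
  have hk: "h @ k \<approx> pnword p [] @ npword q r @ pnword [] s"
    using word_eq.app[OF h(2) k(2)] by (simp add: pnword_def npword_def)
  have hk': "h' @ k' \<approx> pnword p' [] @ npword q' r' @ pnword [] s'"
    using word_eq.app[OF h'(2) k'(2)] by (simp add: pnword_def npword_def)
  have g: "geodesic (pnword p [] @ npword q r @ pnword [] s)"
    using geodesic_weq[OF assms(1) hk] h k by (simp add: length_letter_counts letter_counts_append)
  have g': "geodesic (pnword p' [] @ npword q' r' @ pnword [] s')"
    using geodesic_weq[OF assms(2) hk'] h' k' by (simp add: length_letter_counts letter_counts_append)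
  obtain a b where ab: "npword q r \<approx> pnword a b" "letter_counts (npword q r) = (length a, length b)"
    using geodesic_normal_form g geodesic_append by metis
  obtain a' b' where ab': "npword q' r' \<approx> pnword a' b'" "letter_counts (npword q' r') = (length a', length b')"
    using geodesic_normal_form g' geodesic_append by metis
  have gN: "geodesic (pnword p [] @ pnword a b @ pnword [] s)"
      "pnword p [] @ npword q r @ pnword [] s \<approx> pnword p [] @ pnword a b @ pnword [] s"
    using geodesic_replace[OF g ab(1)] ab(2) by simp_all
  have "pnword p [] @ pnword a b @ pnword [] s = pnword (p @ a) (b @ s)"
    by (simp add: pnword_def)
  then have N: "reduced (p @ a) (b @ s)" "h @ k \<approx> pnword (p @ a) (b @ s)"
    using gN geodesic_imp_reduced weq_trans[OF hk] by simp_all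
  have gN': "geodesic (pnword p' [] @ pnword a' b' @ pnword [] s')"
      "pnword p' [] @ npword q' r' @ pnword [] s' \<approx> pnword p' [] @ pnword a' b' @ pnword [] s'"
    using geodesic_replace[OF g' ab'(1)] ab'(2) by simp_all
  have "pnword p' [] @ pnword a' b' @ pnword [] s' = pnword (p' @ a') (b' @ s')"
    by (simp add: pnword_def)
  then have N': "reduced (p' @ a') (b' @ s')" "h' @ k' \<approx> pnword (p' @ a') (b' @ s')"
    using gN' geodesic_imp_reduced weq_trans[OF hk'] by simp_all
  have "p @ a = p' @ a' \<and> b @ s = b' @ s'"
    using normal_form_unique[OF N(1) N'(1)] N N' assms(3) weq_trans weq_sym by blast
  moreover have "length p = length p'" "length s = length s'" using h h' k k' assms by simp_all
  ultimately have 1: "p = p'" "a = a'" "s = s'" "b = b'" by auto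
  have "npword q r \<approx> npword q' r'" using ab ab' 1 weq_trans weq_sym by blast
  then have 2: "q = q'" "r = r'"
    using npword_unique g g' geodesic_append by metis+
  show ?thesis using h h' k k' 1 2 weq_trans weq_sym by blast
qed

section \<open>The shape function on the group\<close>

abbreviation cls :: "'p gword \<Rightarrow> 'p gword set" where
  "cls \<equiv> word_class P (triella_relators T)"

abbreviation \<Gamma> :: "'p gword set monoid" where
  "\<Gamma> \<equiv> A2_group P T"

lemma group_\<Gamma>: "group \<Gamma>"
  unfolding A2_group_def by (rule group_presented_group)

lemma cls_eq: "u \<in> gwords P \<Longrightarrow> cls u = cls v \<longleftrightarrow> u \<approx> v"
  by (rule word_class_eq_iff)

lemma cls_mult: "u \<in> gwords P \<Longrightarrow> v \<in> gwords P \<Longrightarrow> cls u \<otimes>\<^bsub>\<Gamma>\<^esub> cls v = cls (u @ v)"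
  unfolding A2_group_def by (rule presented_group_mult)

lemma cls_carrier: "u \<in> gwords P \<Longrightarrow> cls u \<in> carrier \<Gamma>"
  by (simp add: A2_group_def presented_group_def)

lemma cls_one: "\<one>\<^bsub>\<Gamma>\<^esub> = cls []"
  by (simp add: A2_group_def presented_group_def)

lemma cls_inv: "y \<in> P \<Longrightarrow> inv\<^bsub>\<Gamma>\<^esub> (cls [(y, True)]) = cls [(y, False)]"
proof -
  assume y: "y \<in> P"
  have "[(y, False), (y, True)] \<approx> []" using word_eq.cancel[OF y, of _ False] by simp
  then have "cls [(y, False)] \<otimes>\<^bsub>\<Gamma>\<^esub> cls [(y, True)] = \<one>\<^bsub>\<Gamma>\<^esub>"
    using y by (simp add: cls_mult cls_one cls_eq)
  then show ?thesis using group.inv_equality[OF group_\<Gamma>] cls_carrier y by simp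
qed

lemma foldr_cls:
  assumes "set xs \<subseteq> P" "set ys \<subseteq> P"
  shows "foldr (monoid.mult \<Gamma>) (map (A2_gen P T) xs @ map (\<lambda>y. inv\<^bsub>\<Gamma>\<^esub> (A2_gen P T y)) ys) \<one>\<^bsub>\<Gamma>\<^esub>
    = cls (pnword xs ys)"
proof -
  have 1: "foldr (monoid.mult \<Gamma>) (map (\<lambda>y. inv\<^bsub>\<Gamma>\<^esub> (A2_gen P T y)) ys) \<one>\<^bsub>\<Gamma>\<^esub> = cls (pnword [] ys)
    \<and> pnword [] ys \<in> gwords P"
    using assms(2) by (induction ys) (auto simp: pnword_simps cls_one A2_gen_def cls_inv cls_mult)
  have "foldr (monoid.mult \<Gamma>) (map (A2_gen P T) xs @ map (\<lambda>y. inv\<^bsub>\<Gamma>\<^esub> (A2_gen P T y)) ys) \<one>\<^bsub>\<Gamma>\<^esub>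
    = cls (pnword xs ys) \<and> pnword xs ys \<in> gwords P"
    using assms(1) by (induction xs) (use 1 in \<open>auto simp: pnword_simps A2_gen_def cls_mult\<close>)
  then show ?thesis by blast
qed

text \<open>The shape function expressed through \<open>T\<close> alone; \<open>A2_shape_eq\<close>
  identifies it with \<open>A2_shape\<close>.\<close>

definition shape :: "'p gword set \<Rightarrow> nat \<times> nat" where
  "shape w = (THE mn. \<exists>xs ys. (reduced xs ys \<and> w = cls (pnword xs ys)) \<and> mn = (length xs, length ys))"

lemma shape_cls:
  assumes "geodesic u"
  shows "shape (cls u) = letter_counts u"
proof -
  obtain xs ys where n: "reduced xs ys" "u \<approx> pnword xs ys" "letter_counts u = (length xs, length ys)"
    using geodesic_normal_form assms by metis
  have u: "u \<in> gwords P" using assms geodesic_def by blast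
  show ?thesis unfolding shape_def
  proof (rule the_equality)
    show "\<exists>xs ys. (reduced xs ys \<and> cls u = cls (pnword xs ys)) \<and> letter_counts u = (length xs, length ys)"
      using n cls_eq u by blast
    fix mn assume "\<exists>xs ys. (reduced xs ys \<and> cls u = cls (pnword xs ys)) \<and> mn = (length xs, length ys)"
    then show "mn = letter_counts u" using n cls_eq[OF u] normal_form_unique weq_trans weq_sym by metis
  qed
qed

lemma geodesic_rep:
  assumes "w \<in> carrier \<Gamma>"
  obtains u where "geodesic u" "w = cls u" "shape w = letter_counts u"
proof -
  obtain v where v: "v \<in> gwords P" "w = cls v"
    using assms by (auto simp: A2_group_def presented_group_def)
  then obtain u where "geodesic u" "v \<approx> u" using geodesic_ex by blast
  then show ?thesis using that v cls_eq shape_cls by metis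
qed

lemma geodesic_gwords: "geodesic u \<Longrightarrow> u \<in> gwords P"
  by (simp add: geodesic_def)

text \<open>Translates additivity of shapes into concatenation of geodesics: a geodesic for the
  product with the letter counts of \<open>u @ v\<close> also has its length.\<close>

lemma shape_mult_geodesic:
  assumes "geodesic u" "geodesic v"
  shows "shape (cls u \<otimes>\<^bsub>\<Gamma>\<^esub> cls v) = letter_counts u + letter_counts v \<longleftrightarrow> geodesic (u @ v)"
proof
  assume *: "shape (cls u \<otimes>\<^bsub>\<Gamma>\<^esub> cls v) = letter_counts u + letter_counts v"
  have uv: "u @ v \<in> gwords P" using assms geodesic_gwords by simp
  then obtain z where z: "geodesic z" "u @ v \<approx> z" using geodesic_ex by blast
  then have "letter_counts z = letter_counts (u @ v)"
    using * assms uv shape_cls cls_mult geodesic_gwords cls_eq letter_counts_append by metis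
  then show "geodesic (u @ v)" using geodesic_weq[OF z(1) weq_sym[OF z(2)]] by (simp add: length_letter_counts)
next
  assume "geodesic (u @ v)"
  then show "shape (cls u \<otimes>\<^bsub>\<Gamma>\<^esub> cls v) = letter_counts u + letter_counts v"
    using assms cls_mult geodesic_gwords shape_cls letter_counts_append by simp
qed

end

section \<open>Axioms for shape functions\<close>

definition total :: "nat \<times> nat \<Rightarrow> nat" where
  "total m = fst m + snd m"

text \<open>The interface between normal forms and 2-graphs. For the group of a triangle
  presentation \<open>total\<close> of the shape is word length, so \<open>shape_mult\<close> says
  that a product either concatenates geodesically or becomes strictly shorter. The axiom
  \<open>glue\<close> is what composition of morphisms at a common vertex requires.\<close>

locale shape_group = group G for G :: "('g, 'm) monoid_scheme" (structure) +
  fixes \<delta> :: "'g \<Rightarrow> nat \<times> nat"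
  assumes shape_eq_0: "w \<in> carrier G \<Longrightarrow> \<delta> w = (0, 0) \<longleftrightarrow> w = \<one>"
    and shape_mult: "h \<in> carrier G \<Longrightarrow> k \<in> carrier G \<Longrightarrow>
      \<delta> (h \<otimes> k) = \<delta> h + \<delta> k \<or> total (\<delta> (h \<otimes> k)) < total (\<delta> h) + total (\<delta> k)"
    and factor_ex: "w \<in> carrier G \<Longrightarrow> \<delta> w = m + n \<Longrightarrow>
      \<exists>h k. h \<in> carrier G \<and> k \<in> carrier G \<and> w = h \<otimes> k \<and> \<delta> h = m \<and> \<delta> k = n"
    and factor_unique: "h \<in> carrier G \<Longrightarrow> k \<in> carrier G \<Longrightarrow> h' \<in> carrier G \<Longrightarrow> k' \<in> carrier G \<Longrightarrow>
      h \<otimes> k = h' \<otimes> k' \<Longrightarrow> \<delta> h = \<delta> h' \<Longrightarrow> \<delta> k = \<delta> k' \<Longrightarrow> \<delta> (h \<otimes> k) = \<delta> h + \<delta> k \<Longrightarrow> h = h' \<and> k = k'"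
    and glue: "h \<in> carrier G \<Longrightarrow> s \<in> carrier G \<Longrightarrow> k \<in> carrier G \<Longrightarrow> \<delta> s = (1, 1) \<Longrightarrow>
      \<delta> (h \<otimes> s) = \<delta> h + \<delta> s \<Longrightarrow> \<delta> (s \<otimes> k) = \<delta> s + \<delta> k \<Longrightarrow>
      \<delta> (h \<otimes> s \<otimes> k) = \<delta> h + \<delta> s + \<delta> k"

lemma (in triangle_presentation) shape_group: "shape_group \<Gamma> shape"
proof -
  interpret group \<Gamma> by (rule group_\<Gamma>)
  show ?thesis
  proof
    show "shape w = (0, 0) \<longleftrightarrow> w = \<one>\<^bsub>\<Gamma>\<^esub>" if w: "w \<in> carrier \<Gamma>" for w
    proof -
      obtain u where u: "geodesic u" "w = cls u" "shape w = letter_counts u" by (rule geodesic_rep[OF w])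
      have "geodesic []" by (simp add: geodesic_def)
      then have "shape \<one>\<^bsub>\<Gamma>\<^esub> = (0, 0)" by (simp add: cls_one shape_cls letter_counts_def)
      moreover have "u = []" if "letter_counts u = (0, 0)" using length_letter_counts[of u] that by simp
      ultimately show ?thesis using u by (auto simp: cls_one)
    qed
  next
    fix h k assume c: "h \<in> carrier \<Gamma>" "k \<in> carrier \<Gamma>"
    obtain u where u: "geodesic u" "h = cls u" "shape h = letter_counts u" by (rule geodesic_rep[OF c(1)])
    obtain v where v: "geodesic v" "k = cls v" "shape k = letter_counts v" by (rule geodesic_rep[OF c(2)])
    have uv: "u @ v \<in> gwords P" using u v geodesic_gwords by simp
    then obtain z where z: "geodesic z" "u @ v \<approx> z" "length z < length (u @ v) \<or> letter_counts z = letter_counts (u @ v)"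
      using geodesic_ex by blast
    have "shape (h \<otimes>\<^bsub>\<Gamma>\<^esub> k) = letter_counts z"
      using u v z(1,2) uv shape_cls cls_mult geodesic_gwords cls_eq by metis
    then show "shape (h \<otimes>\<^bsub>\<Gamma>\<^esub> k) = shape h + shape k \<or>
        total (shape (h \<otimes>\<^bsub>\<Gamma>\<^esub> k)) < total (shape h) + total (shape k)"
      using z(3) u v by (auto simp: total_def letter_counts_append length_letter_counts)
  next
    fix w m n assume w: "w \<in> carrier \<Gamma>" and mn: "shape w = m + n"
    obtain u where u: "geodesic u" "w = cls u" "shape w = letter_counts u" by (rule geodesic_rep[OF w])
    then obtain h k where hk: "geodesic (h @ k)" "u \<approx> h @ k" "letter_counts h = m" "letter_counts k = n"
      using factor_ex mn by metis
    have g: "geodesic h" "geodesic k" using geodesic_append hk by blast+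
    then have "w = cls h \<otimes>\<^bsub>\<Gamma>\<^esub> cls k" using u hk geodesic_gwords cls_mult cls_eq by metis
    then show "\<exists>h k. h \<in> carrier \<Gamma> \<and> k \<in> carrier \<Gamma> \<and> w = h \<otimes>\<^bsub>\<Gamma>\<^esub> k \<and> shape h = m \<and> shape k = n"
      using g hk shape_cls cls_carrier geodesic_gwords by metis
  next
    fix h k h' k'
    assume c: "h \<in> carrier \<Gamma>" "k \<in> carrier \<Gamma>" "h' \<in> carrier \<Gamma>" "k' \<in> carrier \<Gamma>"
      and eq: "h \<otimes>\<^bsub>\<Gamma>\<^esub> k = h' \<otimes>\<^bsub>\<Gamma>\<^esub> k'" "shape h = shape h'" "shape k = shape k'"
        "shape (h \<otimes>\<^bsub>\<Gamma>\<^esub> k) = shape h + shape k"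
    obtain u where u: "geodesic u" "h = cls u" "shape h = letter_counts u" by (rule geodesic_rep[OF c(1)])
    obtain v where v: "geodesic v" "k = cls v" "shape k = letter_counts v" by (rule geodesic_rep[OF c(2)])
    obtain u' where u': "geodesic u'" "h' = cls u'" "shape h' = letter_counts u'" by (rule geodesic_rep[OF c(3)])
    obtain v' where v': "geodesic v'" "k' = cls v'" "shape k' = letter_counts v'" by (rule geodesic_rep[OF c(4)])
    have g: "u \<in> gwords P" "v \<in> gwords P" "u' \<in> gwords P" "v' \<in> gwords P"
      using u v u' v' geodesic_gwords by blast+
    have "geodesic (u @ v)" using shape_mult_geodesic u v eq by metis
    moreover have "geodesic (u' @ v')" using shape_mult_geodesic u' v' eq u v by metis
    moreover have "u @ v \<approx> u' @ v'" using eq(1) u v u' v' g by (simp add: cls_mult cls_eq)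
    ultimately show "h = h' \<and> k = k'" using factor_unique[of u v u' v'] u v u' v' eq cls_eq g by metis
  next
    fix h s k
    assume c: "h \<in> carrier \<Gamma>" "s \<in> carrier \<Gamma>" "k \<in> carrier \<Gamma>" "shape s = (1, 1)"
      and eq: "shape (h \<otimes>\<^bsub>\<Gamma>\<^esub> s) = shape h + shape s" "shape (s \<otimes>\<^bsub>\<Gamma>\<^esub> k) = shape s + shape k"
    obtain u where u: "geodesic u" "h = cls u" "shape h = letter_counts u" by (rule geodesic_rep[OF c(1)])
    obtain v where v: "geodesic v" "s = cls v" "shape s = letter_counts v" by (rule geodesic_rep[OF c(2)])
    obtain w where w: "geodesic w" "k = cls w" "shape k = letter_counts w" by (rule geodesic_rep[OF c(3)])
    have "geodesic (u @ v)" "geodesic (v @ w)" using shape_mult_geodesic u v w eq by metis+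
    then have "geodesic (u @ v @ w)" using glue v c by metis
    then show "shape (h \<otimes>\<^bsub>\<Gamma>\<^esub> s \<otimes>\<^bsub>\<Gamma>\<^esub> k) = shape h + shape s + shape k"
      using shape_cls[of "u @ v @ w"] u v w geodesic_gwords by (simp add: cls_mult letter_counts_append add.assoc)
  qed
qed

section \<open>From triellas to triangle presentations\<close>

text \<open>By \<open>T1\<close> incidence of \<open>x\<close> with \<open>lam t\<close> is the
  existence of a triple starting with \<open>t\<close> and \<open>x\<close>. Since
  \<open>lam\<close> is a bijection, the line through two points yields \<open>join_ex\<close> and
  \<open>join_unique\<close>, and the common point of two lines yields
  \<open>meet_ex\<close>.\<close>

lemma (in triella) triangle_presentation: "triangle_presentation P T"
proof
  have lam: "lam t \<in> L" if "t \<in> P" for t using lam_bij that by (auto simp: bij_betw_def)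
  have inj: "t = t'" if "lam t = lam t'" "t \<in> P" "t' \<in> P" for t t'
    using lam_bij that by (auto simp: bij_betw_def inj_on_def)
  have on: "on x (lam t)" if "(t, x, u) \<in> T" for t x u using T1[of t x] T_subset that by auto
  show "T \<subseteq> P \<times> P \<times> P" by (rule T_subset)
  show "(y, z, x) \<in> T" if "(x, y, z) \<in> T" for x y z using that by (rule T2)
  show "z = z'" if "(x, y, z) \<in> T" "(x, y, z') \<in> T" for x y z z' using that by (rule T3)
  show "\<exists>t u v. (t, x, u) \<in> T \<and> (t, y, v) \<in> T" if xy: "x \<in> P" "y \<in> P" "x \<noteq> y" for x y
  proof -
    obtain l where l: "l \<in> L" "on x l" "on y l" using unique_line[OF xy] by blast
    then obtain t where "t \<in> P" "l = lam t" using lam_bij by (auto simp: bij_betw_def)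
    then show ?thesis using T1 l xy by metis
  qed
  show "\<exists>t u v. (x, t, u) \<in> T \<and> (y, t, v) \<in> T" if xy: "x \<in> P" "y \<in> P" "x \<noteq> y" for x y
  proof -
    have "lam x \<noteq> lam y" using inj xy by blast
    then obtain t where "t \<in> P" "on t (lam x)" "on t (lam y)" using unique_point lam xy by blast
    then show ?thesis using T1 xy by metis
  qed
  show "t = t'" if xy: "x \<noteq> y" and T: "(t, x, u) \<in> T" "(t, y, v) \<in> T"
      "(t', x, u') \<in> T" "(t', y, v') \<in> T" for x y t t' u u' v v'
  proof -
    have "t \<in> P" "t' \<in> P" "x \<in> P" "y \<in> P" using T T_subset by auto
    then show ?thesis using inj unique_line[of x y] xy on T lam by metis
  qed
qed

text \<open>The two notions of normal form agree: \<open>T1\<close> translates the adjacency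
  conditions, and \<open>foldr_cls\<close> evaluates the product of generators.\<close>

lemma (in triella) A2_shape_eq: "A2_shape P on lam T = triangle_presentation.shape P T"
proof
  fix w
  interpret triangle_presentation P T by (rule triangle_presentation)
  have on: "on y (lam x) \<longleftrightarrow> (\<exists>z. (x, y, z) \<in> T)" if "x \<in> P" "y \<in> P" for x y
    using T1[OF that] T_subset by auto
  have "A2_normal_form P on lam T w xs ys \<longleftrightarrow> reduced xs ys \<and> w = cls (pnword xs ys)" for xs ys
  proof (cases "set xs \<subseteq> P \<and> set ys \<subseteq> P")
    case True
    have "successively (\<lambda>x x'. \<not> on x' (lam x)) xs \<longleftrightarrow> successively (\<lambda>x x'. \<nexists>z. (x, x', z) \<in> T) xs"
      "successively (\<lambda>y y'. \<not> on y (lam y')) ys \<longleftrightarrow> successively (\<lambda>y y'. \<nexists>z. (y', y, z) \<in> T) ys"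
      by (rule successively_cong; use True on in blast)+
    then show ?thesis using True foldr_cls[of xs ys] unfolding A2_normal_form_def reduced_defs by auto
  next
    case False
    then show ?thesis by (auto simp: A2_normal_form_def reduced_defs)
  qed
  then show "A2_shape P on lam T w = shape w" unfolding A2_shape_def shape_def by simp
qed

section \<open>Skew products and transport of 2-graph structures\<close>

lemma ex1_pairI:
  assumes "Q g h" "\<And>g' h'. Q g' h' \<Longrightarrow> g' = g \<and> h' = h"
  shows "\<exists>!(g, h). Q g h"
proof (rule ex1I[of _ "(g, h)"])
  fix p assume "case p of (g, h) \<Rightarrow> Q g h"
  then show "p = (g, h)" using assms(2)[of "fst p" "snd p"] by (simp add: case_prod_unfold prod_eq_iff)
qed (simp add: assms(1))

lemma ex1_pairE:
  assumes "\<exists>!(g, h). Q g h"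
  obtains g h where "Q g h" "\<And>g' h'. Q g' h' \<Longrightarrow> g' = g \<and> h' = h"
proof -
  obtain p where p: "case p of (g, h) \<Rightarrow> Q g h" "\<And>p'. (case p' of (g, h) \<Rightarrow> Q g h) \<Longrightarrow> p' = p"
    using assms by (elim ex1E) blast
  obtain g h where "p = (g, h)" by (cases p)
  then show ?thesis using that[of g h] p by blast
qed

text \<open>The axioms of a 2-graph are pulled back along the bijection, so only the target need be
  known to be a 2-graph. It is applied to the pair graph, to the translations, and to the
  quotient.\<close>

lemma two_graph_iso_transport:
  assumes "two_graph M" "bij_betw \<phi> (Mor \<Lambda>) (Mor M)" "\<phi> ` Obj \<Lambda> = Obj M" "Obj \<Lambda> \<subseteq> Mor \<Lambda>"
    and Rng: "\<And>f. f \<in> Mor \<Lambda> \<Longrightarrow> Rng \<Lambda> f \<in> Mor \<Lambda> \<and> \<phi> (Rng \<Lambda> f) = Rng M (\<phi> f)"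
    and Src: "\<And>f. f \<in> Mor \<Lambda> \<Longrightarrow> Src \<Lambda> f \<in> Mor \<Lambda> \<and> \<phi> (Src \<Lambda> f) = Src M (\<phi> f)"
    and Deg: "\<And>f. f \<in> Mor \<Lambda> \<Longrightarrow> Deg M (\<phi> f) = Deg \<Lambda> f"
    and Cmp: "\<And>f g. f \<in> Mor \<Lambda> \<Longrightarrow> g \<in> Mor \<Lambda> \<Longrightarrow> Src \<Lambda> f = Rng \<Lambda> g \<Longrightarrow>
      Cmp \<Lambda> f g \<in> Mor \<Lambda> \<and> \<phi> (Cmp \<Lambda> f g) = Cmp M (\<phi> f) (\<phi> g)"
  shows "two_graph_iso \<Lambda> M \<phi>"
proof -
  interpret M: two_graph M by fact
  have mor: "\<phi> f \<in> Mor M" if "f \<in> Mor \<Lambda>" for f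
    using assms(2) that by (auto simp: bij_betw_def)
  have inj: "f = g" if "\<phi> f = \<phi> g" "f \<in> Mor \<Lambda>" "g \<in> Mor \<Lambda>" for f g
    using assms(2) that by (auto simp: bij_betw_def inj_on_def)
  have obj: "f \<in> Obj \<Lambda> \<longleftrightarrow> \<phi> f \<in> Obj M" if "f \<in> Mor \<Lambda>" for f
  proof
    assume "\<phi> f \<in> Obj M"
    then obtain v where "v \<in> Obj \<Lambda>" "\<phi> f = \<phi> v" using assms(3) by blast
    then show "f \<in> Obj \<Lambda>" using inj that assms(4) by blast
  qed (use assms(3) in blast)
  \<comment> \<open>Injectivity makes composability reflected as well as preserved.\<close>
  have comp: "Src \<Lambda> f = Rng \<Lambda> g \<longleftrightarrow> Src M (\<phi> f) = Rng M (\<phi> g)" if "f \<in> Mor \<Lambda>" "g \<in> Mor \<Lambda>" for f g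
    using Rng Src inj that by metis
  have surj: "\<exists>f\<in>Mor \<Lambda>. h = \<phi> f" if "h \<in> Mor M" for h
    using assms(2) that by (auto simp: bij_betw_def)
  have "two_graph \<Lambda>"
  proof
    show "Obj \<Lambda> \<subseteq> Mor \<Lambda>" by fact
    show "Rng \<Lambda> f \<in> Obj \<Lambda>" if "f \<in> Mor \<Lambda>" for f
      using that obj Rng mor M.Rng_closed by metis
    show "Src \<Lambda> f \<in> Obj \<Lambda>" if "f \<in> Mor \<Lambda>" for f
      using that obj Src mor M.Src_closed by metis
    show "Rng \<Lambda> v = v" if "v \<in> Obj \<Lambda>" for v
      using that obj Rng inj assms(4) M.Rng_Obj by (metis subsetD)
    show "Src \<Lambda> v = v" if "v \<in> Obj \<Lambda>" for v
      using that obj Src inj assms(4) M.Src_Obj by (metis subsetD)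
    show "Deg \<Lambda> v = (0, 0)" if "v \<in> Obj \<Lambda>" for v
      using that obj Deg assms(4) M.Deg_Obj by (metis subsetD)
    show "Cmp \<Lambda> (Rng \<Lambda> f) f = f" if f: "f \<in> Mor \<Lambda>" for f
    proof (rule inj)
      have "Src \<Lambda> (Rng \<Lambda> f) = Rng \<Lambda> f"
        using comp[of "Rng \<Lambda> f" f] f Rng M.Src_Obj M.Rng_closed mor by metis
      then show "\<phi> (Cmp \<Lambda> (Rng \<Lambda> f) f) = \<phi> f" "Cmp \<Lambda> (Rng \<Lambda> f) f \<in> Mor \<Lambda>"
        using Cmp Rng f M.Cmp_Rng mor by metis+
    qed fact
    show "Cmp \<Lambda> f (Src \<Lambda> f) = f" if f: "f \<in> Mor \<Lambda>" for f
    proof (rule inj)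
      have "Src \<Lambda> f = Rng \<Lambda> (Src \<Lambda> f)"
        using comp[of f "Src \<Lambda> f"] f Src M.Rng_Obj M.Src_closed mor by metis
      then show "\<phi> (Cmp \<Lambda> f (Src \<Lambda> f)) = \<phi> f" "Cmp \<Lambda> f (Src \<Lambda> f) \<in> Mor \<Lambda>"
        using Cmp Src f M.Cmp_Src mor by metis+
    qed fact
    fix f g assume fg: "f \<in> Mor \<Lambda>" "g \<in> Mor \<Lambda>" "Src \<Lambda> f = Rng \<Lambda> g"
    then have fg': "\<phi> f \<in> Mor M" "\<phi> g \<in> Mor M" "Src M (\<phi> f) = Rng M (\<phi> g)"
      using mor comp by blast+
    show C: "Cmp \<Lambda> f g \<in> Mor \<Lambda>" using Cmp fg by blast
    show "Rng \<Lambda> (Cmp \<Lambda> f g) = Rng \<Lambda> f"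
      using inj Rng[OF C] Rng[OF fg(1)] Cmp[OF fg] M.Rng_Cmp[OF fg'] by metis
    show SC: "Src \<Lambda> (Cmp \<Lambda> f g) = Src \<Lambda> g"
      using inj Src[OF C] Src[OF fg(2)] Cmp[OF fg] M.Src_Cmp[OF fg'] by metis
    show "Deg \<Lambda> (Cmp \<Lambda> f g) = Deg \<Lambda> f + Deg \<Lambda> g"
      using Deg[OF C] Deg[OF fg(1)] Deg[OF fg(2)] Cmp[OF fg] M.Deg_Cmp[OF fg'] by metis
    fix h assume h: "h \<in> Mor \<Lambda>" "Src \<Lambda> g = Rng \<Lambda> h"
    then have h': "\<phi> h \<in> Mor M" "Src M (\<phi> g) = Rng M (\<phi> h)"
      using mor comp fg by blast+
    have gh: "Cmp \<Lambda> g h \<in> Mor \<Lambda>" "\<phi> (Cmp \<Lambda> g h) = Cmp M (\<phi> g) (\<phi> h)" using Cmp fg h by blast+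
    have R: "Src \<Lambda> f = Rng \<Lambda> (Cmp \<Lambda> g h)"
      using comp[OF fg(1) gh(1)] gh(2) M.Rng_Cmp[OF fg'(2) h'] fg'(3) by simp
    have S: "Src \<Lambda> (Cmp \<Lambda> f g) = Rng \<Lambda> h" using SC h by simp
    show "Cmp \<Lambda> (Cmp \<Lambda> f g) h = Cmp \<Lambda> f (Cmp \<Lambda> g h)"
      using inj Cmp[OF C h(1) S] Cmp[OF fg(1) gh(1) R] gh(2) Cmp[OF fg]
        M.Cmp_assoc[OF fg'(1,2) h'(1) fg'(3) h'(2)] by metis
  next
    fix f m n assume f: "f \<in> Mor \<Lambda>" "Deg \<Lambda> f = m + n"
    then have "\<phi> f \<in> Mor M" "Deg M (\<phi> f) = m + n" using mor Deg by simp_all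
    from M.factorisation[OF this] obtain g' h' where gh': "g' \<in> Mor M \<and> h' \<in> Mor M \<and> Src M g' = Rng M h'
        \<and> Deg M g' = m \<and> Deg M h' = n \<and> \<phi> f = Cmp M g' h'"
      and uniq: "\<And>g h. g \<in> Mor M \<and> h \<in> Mor M \<and> Src M g = Rng M h
        \<and> Deg M g = m \<and> Deg M h = n \<and> \<phi> f = Cmp M g h \<Longrightarrow> g = g' \<and> h = h'"
      by (rule ex1_pairE) blast
    obtain g h where gh: "g \<in> Mor \<Lambda>" "h \<in> Mor \<Lambda>" "g' = \<phi> g" "h' = \<phi> h" using surj gh' by metis
    then have gh2: "Src \<Lambda> g = Rng \<Lambda> h" "Deg \<Lambda> g = m" "Deg \<Lambda> h = n" using comp gh' Deg by metis+
    then have gh3: "f = Cmp \<Lambda> g h" using inj Cmp gh gh' f by metis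
    show "\<exists>!(g, h). g \<in> Mor \<Lambda> \<and> h \<in> Mor \<Lambda> \<and> Src \<Lambda> g = Rng \<Lambda> h
            \<and> Deg \<Lambda> g = m \<and> Deg \<Lambda> h = n \<and> f = Cmp \<Lambda> g h"
    proof (rule ex1_pairI, intro conjI)
      fix g2 h2 assume p: "g2 \<in> Mor \<Lambda> \<and> h2 \<in> Mor \<Lambda> \<and> Src \<Lambda> g2 = Rng \<Lambda> h2
            \<and> Deg \<Lambda> g2 = m \<and> Deg \<Lambda> h2 = n \<and> f = Cmp \<Lambda> g2 h2"
      have "\<phi> g2 = g' \<and> \<phi> h2 = h'"
        by (rule uniq) (use p mor comp[of g2 h2] Deg Cmp in auto)
      then show "g2 = g \<and> h2 = h" using inj gh p by blast
    qed (use gh gh2 gh3 in auto)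
  qed
  then show ?thesis
    unfolding two_graph_iso_def using assms(1-3) Rng Src Deg Cmp by simp
qed

text \<open>In a factorisation of \<open>(x, a)\<close> the group coordinates are forced to be
  \<open>x\<close> and \<open>x\<close> times \<open>c g\<close>, so existence and uniqueness come
  from the second coordinate.\<close>

lemma two_graph_skew_product:
  assumes "group G" "two_graph \<Lambda>" "cocycle G \<Lambda> c"
  shows "two_graph (skew_product G c \<Lambda>)"
proof -
  interpret G: group G by fact
  interpret two_graph \<Lambda> by fact
  have c: "f \<in> Mor \<Lambda> \<Longrightarrow> c f \<in> carrier G" "v \<in> Obj \<Lambda> \<Longrightarrow> c v = \<one>\<^bsub>G\<^esub>"
    "f \<in> Mor \<Lambda> \<Longrightarrow> g \<in> Mor \<Lambda> \<Longrightarrow> Src \<Lambda> f = Rng \<Lambda> g \<Longrightarrow> c (Cmp \<Lambda> f g) = c f \<otimes>\<^bsub>G\<^esub> c g" for f g v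
    using assms(3) by (auto simp: cocycle_def)
  show ?thesis
  proof
    fix f m n assume f: "f \<in> Mor (skew_product G c \<Lambda>)" "Deg (skew_product G c \<Lambda>) f = m + n"
    obtain x a where xa: "f = (x, a)" by (cases f)
    then have a: "x \<in> carrier G" "a \<in> Mor \<Lambda>" "Deg \<Lambda> a = m + n" using f by (auto simp: skew_product_def)
    from factorisation[OF a(2,3)] obtain g h where gh: "g \<in> Mor \<Lambda> \<and> h \<in> Mor \<Lambda> \<and> Src \<Lambda> g = Rng \<Lambda> h
        \<and> Deg \<Lambda> g = m \<and> Deg \<Lambda> h = n \<and> a = Cmp \<Lambda> g h"
      and uniq: "\<And>g' h'. g' \<in> Mor \<Lambda> \<and> h' \<in> Mor \<Lambda> \<and> Src \<Lambda> g' = Rng \<Lambda> h'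
        \<and> Deg \<Lambda> g' = m \<and> Deg \<Lambda> h' = n \<and> a = Cmp \<Lambda> g' h' \<Longrightarrow> g' = g \<and> h' = h"
      by (rule ex1_pairE) blast
    show "\<exists>!(g, h). g \<in> Mor (skew_product G c \<Lambda>) \<and> h \<in> Mor (skew_product G c \<Lambda>)
        \<and> Src (skew_product G c \<Lambda>) g = Rng (skew_product G c \<Lambda>) h
        \<and> Deg (skew_product G c \<Lambda>) g = m \<and> Deg (skew_product G c \<Lambda>) h = n
        \<and> f = Cmp (skew_product G c \<Lambda>) g h"
    proof (rule ex1_pairI)
      fix p p' assume *: "p \<in> Mor (skew_product G c \<Lambda>) \<and> p' \<in> Mor (skew_product G c \<Lambda>)
        \<and> Src (skew_product G c \<Lambda>) p = Rng (skew_product G c \<Lambda>) p'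
        \<and> Deg (skew_product G c \<Lambda>) p = m \<and> Deg (skew_product G c \<Lambda>) p' = n
        \<and> f = Cmp (skew_product G c \<Lambda>) p p'"
      obtain y g' y' h' where p: "p = (y, g')" "p' = (y', h')" by (cases p, cases p')
      then have "g' = g \<and> h' = h" using * xa by (intro uniq) (simp add: skew_product_def)
      then show "p = (x, g) \<and> p' = (x \<otimes>\<^bsub>G\<^esub> c g, h)" using * xa p by (simp add: skew_product_def)
    qed (use xa a gh c in \<open>simp add: skew_product_def\<close>)
  qed (use Obj_subset in \<open>auto simp: skew_product_def c Rng_closed Src_closed Rng_Obj Src_Obj
      Cmp_closed Rng_Cmp Src_Cmp Cmp_assoc Cmp_Rng Cmp_Src Deg_Obj Deg_Cmp G.m_assoc\<close>)
qed

section \<open>The 2-graphs of a group with a shape function\<close>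

context shape_group
begin

text \<open>A drop of \<open>total\<close> in a partial product could not be recovered by the
  remaining multiplication, because \<open>total\<close> is subadditive.\<close>

lemma shape_mult3:
  assumes "h \<in> carrier G" "s \<in> carrier G" "k \<in> carrier G"
    and eq: "\<delta> (h \<otimes> s \<otimes> k) = \<delta> h + \<delta> s + \<delta> k"
  shows "\<delta> (h \<otimes> s) = \<delta> h + \<delta> s" "\<delta> (s \<otimes> k) = \<delta> s + \<delta> k"
proof -
  have add: "total (m + n) = total m + total n" for m n by (simp add: total_def)
  show "\<delta> (h \<otimes> s) = \<delta> h + \<delta> s"
    using shape_mult[of h s] shape_mult[of "h \<otimes> s" k] assms by (auto simp: add)
  have "h \<otimes> s \<otimes> k = h \<otimes> (s \<otimes> k)" using assms m_assoc by simp
  then show "\<delta> (s \<otimes> k) = \<delta> s + \<delta> k"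
    using shape_mult[of s k] shape_mult[of h "s \<otimes> k"] assms by (auto simp: add add.assoc)
qed

section \<open>The 2-graph of elements of shape at least (1, 1)\<close>

abbreviation "\<Lambda> \<equiv> Lambda_graph G \<delta>"
abbreviation "r \<equiv> Lambda_r G \<delta>"
abbreviation "b \<equiv> Lambda_b G \<delta>"
abbreviation "c \<equiv> Lambda_c G \<delta>"
abbreviation "s \<equiv> Lambda_s G \<delta>"

lemma shape_factor_eq:
  assumes "h \<in> carrier G" "k \<in> carrier G" "\<delta> (h \<otimes> k) = \<delta> h + \<delta> k"
  shows "shape_factor G \<delta> (\<delta> h) (\<delta> k) (h \<otimes> k) = (h, k)"
  unfolding shape_factor_def
proof (rule the_equality)
  fix p assume *: "case p of (h', k') \<Rightarrow> h' \<in> carrier G \<and> k' \<in> carrier G \<and>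
    h \<otimes> k = h' \<otimes> k' \<and> \<delta> h' = \<delta> h \<and> \<delta> k' = \<delta> k"
  obtain h' k' where p: "p = (h', k')" by (cases p)
  have "h = h' \<and> k = k'" by (rule factor_unique) (use * p assms in \<open>simp_all only: prod.case\<close>)
  then show "p = (h, k)" using p by simp
qed (use assms in simp)

lemma Lambda_rb_eq:
  assumes "h \<in> carrier G" "k \<in> carrier G" "\<delta> h = (1, 1)" "\<delta> (h \<otimes> k) = (1, 1) + \<delta> k"
  shows "r (h \<otimes> k) = h" "b (h \<otimes> k) = k"
  using shape_factor_eq[of h k] assms by (simp_all add: Lambda_r_def Lambda_b_def)

lemma Lambda_cs_eq:
  assumes "h \<in> carrier G" "k \<in> carrier G" "\<delta> k = (1, 1)" "\<delta> (h \<otimes> k) = \<delta> h + (1, 1)"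
  shows "c (h \<otimes> k) = h" "s (h \<otimes> k) = k"
  using shape_factor_eq[of h k] assms by (simp_all add: Lambda_c_def Lambda_s_def)

lemma Mor_Lambda: "w \<in> Mor \<Lambda> \<longleftrightarrow> w \<in> carrier G \<and> (1, 1) \<le> \<delta> w"
  and Obj_Lambda: "w \<in> Obj \<Lambda> \<longleftrightarrow> w \<in> carrier G \<and> \<delta> w = (1, 1)"
  by (simp_all add: Lambda_graph_def)

lemma le_add_diff_pair: "m \<le> n \<Longrightarrow> n = m + (n - m)" "m \<le> n \<Longrightarrow> n = (n - m) + m" for m n :: "nat \<times> nat"
  by (auto simp: prod_eq_iff less_eq_prod_def)

lemma Lambda_rb:
  assumes "w \<in> Mor \<Lambda>"
  shows "r w \<in> carrier G" "b w \<in> carrier G" "r w \<otimes> b w = w" "\<delta> (r w) = (1, 1)"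
    "\<delta> w = (1, 1) + \<delta> (b w)"
proof -
  have w: "w \<in> carrier G" "\<delta> w = (1, 1) + (\<delta> w - (1, 1))" using assms le_add_diff_pair Mor_Lambda by auto
  obtain h k where hk: "h \<in> carrier G" "k \<in> carrier G" "w = h \<otimes> k" "\<delta> h = (1, 1)" "\<delta> k = \<delta> w - (1, 1)"
    using factor_ex[OF w] by blast
  then have "r w = h" "b w = k" using Lambda_rb_eq[of h k] w(2) by simp_all
  then show "r w \<in> carrier G" "b w \<in> carrier G" "r w \<otimes> b w = w" "\<delta> (r w) = (1, 1)"
    "\<delta> w = (1, 1) + \<delta> (b w)" using hk w(2) by simp_all
qed

lemma Lambda_cs:
  assumes "w \<in> Mor \<Lambda>"
  shows "c w \<in> carrier G" "s w \<in> carrier G" "c w \<otimes> s w = w" "\<delta> (s w) = (1, 1)"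
    "\<delta> w = \<delta> (c w) + (1, 1)"
proof -
  have w: "w \<in> carrier G" "\<delta> w = (\<delta> w - (1, 1)) + (1, 1)" using assms le_add_diff_pair Mor_Lambda by auto
  obtain h k where hk: "h \<in> carrier G" "k \<in> carrier G" "w = h \<otimes> k" "\<delta> h = \<delta> w - (1, 1)" "\<delta> k = (1, 1)"
    using factor_ex[OF w] by blast
  then have "c w = h" "s w = k" using Lambda_cs_eq[of h k] w(2) by simp_all
  then show "c w \<in> carrier G" "s w \<in> carrier G" "c w \<otimes> s w = w" "\<delta> (s w) = (1, 1)"
    "\<delta> w = \<delta> (c w) + (1, 1)" using hk w(2) by simp_all
qed

text \<open>Read off from the trivial factorisations of \<open>v\<close> with the identity on either
  side.\<close>

lemma Obj_rbcs:
  assumes "v \<in> Obj \<Lambda>"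
  shows "r v = v" "b v = \<one>" "c v = \<one>" "s v = v"
  using Lambda_rb_eq[of v \<one>] Lambda_cs_eq[of \<one> v] assms shape_eq_0[of \<one>] by (simp_all add: Obj_Lambda flip: zero_prod_def)

text \<open>By \<open>glue\<close> at the vertex \<open>s f = r g\<close>, the shape is additive on
  the product of \<open>c f\<close>, \<open>s f\<close> and \<open>b g\<close>. Bracketing this
  element as \<open>r f\<close> times \<open>b f \<otimes> b g\<close>, and as
  \<open>c f \<otimes> c g\<close> times \<open>s g\<close>, and using unique factorisation gives
  all four components.\<close>

lemma comp_Lambda:
  assumes "f \<in> Mor \<Lambda>" "g \<in> Mor \<Lambda>" "s f = r g"
  shows "Cmp \<Lambda> f g = f \<otimes> b g" "Cmp \<Lambda> f g \<in> Mor \<Lambda>"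
    "\<delta> (Cmp \<Lambda> f g) = \<delta> f + \<delta> (b g)"
    "r (Cmp \<Lambda> f g) = r f" "b (Cmp \<Lambda> f g) = b f \<otimes> b g"
    "c (Cmp \<Lambda> f g) = c f \<otimes> c g" "s (Cmp \<Lambda> f g) = s g"
proof -
  note f = Lambda_cs[OF assms(1)] Lambda_rb[OF assms(1)] and g = Lambda_rb[OF assms(2)] Lambda_cs[OF assms(2)]
  have fG: "f \<in> carrier G" "g \<in> carrier G" using assms Mor_Lambda by blast+
  show eq: "Cmp \<Lambda> f g = f \<otimes> b g" using f by (simp add: Lambda_graph_def)
  have "\<delta> (c f \<otimes> s f \<otimes> b g) = \<delta> (c f) + \<delta> (s f) + \<delta> (b g)"
    using f g assms(3) by (intro glue) simp_all
  then show \<delta>: "\<delta> (Cmp \<Lambda> f g) = \<delta> f + \<delta> (b g)" using f eq by simp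
  show "Cmp \<Lambda> f g \<in> Mor \<Lambda>"
    using \<delta> eq f(5) fG g by (auto simp: Mor_Lambda less_eq_prod_def)
  have 1: "f \<otimes> b g = r f \<otimes> (b f \<otimes> b g)" using f g m_assoc[of "r f" "b f" "b g"] by simp
  have "\<delta> (r f \<otimes> b f \<otimes> b g) = \<delta> (r f) + \<delta> (b f) + \<delta> (b g)"
    using f g \<delta> eq by simp
  then have "\<delta> (b f \<otimes> b g) = \<delta> (b f) + \<delta> (b g)" using shape_mult3 f g by blast
  then have "\<delta> (r f \<otimes> (b f \<otimes> b g)) = (1, 1) + \<delta> (b f \<otimes> b g)"
    using \<delta> f(10) unfolding eq 1 by (metis add.assoc)
  then show "r (Cmp \<Lambda> f g) = r f" "b (Cmp \<Lambda> f g) = b f \<otimes> b g"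
    using Lambda_rb_eq[of "r f" "b f \<otimes> b g"] f(6,7,9) g(2) unfolding eq 1 by simp_all
  have "f \<otimes> b g = c f \<otimes> (r g \<otimes> b g)" using f g m_assoc[of "c f" "s f" "b g"] assms(3) by simp
  then have 2: "f \<otimes> b g = c f \<otimes> (c g \<otimes> s g)" using g by simp
  then have 3: "f \<otimes> b g = c f \<otimes> c g \<otimes> s g" using f g m_assoc by simp
  have 4: "\<delta> (b g) = \<delta> (c g)" using g(5,10) by (simp add: add.commute)
  have 5: "\<delta> (c f \<otimes> c g \<otimes> s g) = \<delta> (c f) + \<delta> (c g) + \<delta> (s g)"
    using \<delta> f(5) g(9) unfolding eq 3 4 by (simp add: ac_simps)
  then have "\<delta> (c f \<otimes> c g) = \<delta> (c f) + \<delta> (c g)" using shape_mult3 f g by blast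
  then show "c (Cmp \<Lambda> f g) = c f \<otimes> c g" "s (Cmp \<Lambda> f g) = s g"
    using Lambda_cs_eq[of "c f \<otimes> c g" "s g"] f(1) g(6,7,9) 5 unfolding eq 3 by simp_all
qed

lemma Lambda_sel: "Rng \<Lambda> = r" "Src \<Lambda> = s" "Deg \<Lambda> w = \<delta> w - (1, 1)"
  by (simp_all add: Lambda_graph_def)

lemma add_diff_pair: "n + m - n = m" "m + n - n = m" "n \<le> k \<Longrightarrow> k - n = m \<Longrightarrow> k = m + n" for n m k :: "nat \<times> nat"
  by (auto simp: prod_eq_iff less_eq_prod_def)

lemma two_graph_Lambda: "two_graph \<Lambda>"
proof
  show Obj_Mor: "Obj \<Lambda> \<subseteq> Mor \<Lambda>" by (auto simp: Mor_Lambda Obj_Lambda)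
  show R: "Rng \<Lambda> f \<in> Obj \<Lambda>" if "f \<in> Mor \<Lambda>" for f
    using Lambda_rb[OF that] by (simp add: Lambda_sel Obj_Lambda)
  show S: "Src \<Lambda> f \<in> Obj \<Lambda>" if "f \<in> Mor \<Lambda>" for f
    using Lambda_cs[OF that] by (simp add: Lambda_sel Obj_Lambda)
  show "Rng \<Lambda> v = v" "Src \<Lambda> v = v" if "v \<in> Obj \<Lambda>" for v
    using Obj_rbcs[OF that] by (simp_all add: Lambda_sel)
  show "Deg \<Lambda> v = (0, 0)" if "v \<in> Obj \<Lambda>" for v
    using that by (simp add: Lambda_sel Obj_Lambda zero_prod_def)
  show "Cmp \<Lambda> f g \<in> Mor \<Lambda>" "Rng \<Lambda> (Cmp \<Lambda> f g) = Rng \<Lambda> f" "Src \<Lambda> (Cmp \<Lambda> f g) = Src \<Lambda> g"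
    if "f \<in> Mor \<Lambda>" "g \<in> Mor \<Lambda>" "Src \<Lambda> f = Rng \<Lambda> g" for f g
    using comp_Lambda[of f g] that by (simp_all add: Lambda_sel)
  show "Deg \<Lambda> (Cmp \<Lambda> f g) = Deg \<Lambda> f + Deg \<Lambda> g"
    if "f \<in> Mor \<Lambda>" "g \<in> Mor \<Lambda>" "Src \<Lambda> f = Rng \<Lambda> g" for f g
    using comp_Lambda(3)[of f g] that Lambda_cs(5)[of f] Lambda_rb(5)[of g]
    by (simp add: Lambda_sel prod_eq_iff)
  show "Cmp \<Lambda> (Cmp \<Lambda> f g) h = Cmp \<Lambda> f (Cmp \<Lambda> g h)"
    if "f \<in> Mor \<Lambda>" "g \<in> Mor \<Lambda>" "h \<in> Mor \<Lambda>" "Src \<Lambda> f = Rng \<Lambda> g" "Src \<Lambda> g = Rng \<Lambda> h" for f g h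
  proof -
    have fg: "s f = r g" "s g = r h" using that by (simp_all add: Lambda_sel)
    note C = comp_Lambda[OF that(1,2) fg(1)] and C' = comp_Lambda[OF that(2,3) fg(2)]
    have "Cmp \<Lambda> (Cmp \<Lambda> f g) h = f \<otimes> b g \<otimes> b h"
      using comp_Lambda(1)[OF C(2) that(3)] C fg by simp
    moreover have "Cmp \<Lambda> f (Cmp \<Lambda> g h) = f \<otimes> (b g \<otimes> b h)"
      using comp_Lambda(1)[OF that(1) C'(2)] C' fg by simp
    ultimately show ?thesis using Lambda_rb[OF that(2)] Lambda_rb[OF that(3)] that(1) m_assoc Mor_Lambda by simp
  qed
  show "Cmp \<Lambda> (Rng \<Lambda> f) f = f" if "f \<in> Mor \<Lambda>" for f
  proof -
    have "r f \<in> Obj \<Lambda>" using R[OF that] by (simp add: Lambda_sel)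
    then show ?thesis using comp_Lambda(1)[of "r f" f] that Obj_Mor Obj_rbcs Lambda_rb[OF that]
      by (auto simp: Lambda_sel)
  qed
  show "Cmp \<Lambda> f (Src \<Lambda> f) = f" if "f \<in> Mor \<Lambda>" for f
  proof -
    have "s f \<in> Obj \<Lambda>" using S[OF that] by (simp add: Lambda_sel)
    then show ?thesis using comp_Lambda(1)[of f "s f"] that Obj_Mor Obj_rbcs Mor_Lambda
      by (auto simp: Lambda_sel)
  qed
  fix f m n assume f: "f \<in> Mor \<Lambda>" "Deg \<Lambda> f = m + n"
  then have fG: "f \<in> carrier G" and df: "\<delta> f = (m + (1, 1)) + n"
    by (auto simp: Mor_Lambda Lambda_sel prod_eq_iff less_eq_prod_def)
  \<comment> \<open>The first factor receives an extra \<open>(1, 1)\<close>. Its last part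
    \<open>u\<close> is the vertex at which the morphisms \<open>h'\<close> and
    \<open>u \<otimes> k\<close> are composed.\<close>
  obtain h' k where hk: "h' \<in> carrier G" "k \<in> carrier G" "f = h' \<otimes> k" "\<delta> h' = m + (1, 1)" "\<delta> k = n"
    using factor_ex[OF fG df] by blast
  obtain h u where hu: "h \<in> carrier G" "u \<in> carrier G" "h' = h \<otimes> u" "\<delta> h = m" "\<delta> u = (1, 1)"
    using factor_ex[OF hk(1,4)] by blast
  have uk: "\<delta> (u \<otimes> k) = (1, 1) + n"
    using shape_mult3(2)[of h u k] hk hu df by simp
  have M: "h' \<in> Mor \<Lambda>" "u \<otimes> k \<in> Mor \<Lambda>"
    using hk hu uk by (auto simp: Mor_Lambda less_eq_prod_def)
  have rbu: "r (u \<otimes> k) = u" "b (u \<otimes> k) = k" using Lambda_rb_eq[of u k] hk hu uk by simp_all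
  have s: "s h' = u" using Lambda_cs_eq[of h u] hk hu by simp
  have C: "Cmp \<Lambda> h' (u \<otimes> k) = f" using comp_Lambda(1)[OF M] rbu s hk by simp
  show "\<exists>!(g, h). g \<in> Mor \<Lambda> \<and> h \<in> Mor \<Lambda> \<and> Src \<Lambda> g = Rng \<Lambda> h
            \<and> Deg \<Lambda> g = m \<and> Deg \<Lambda> h = n \<and> f = Cmp \<Lambda> g h"
  proof (rule ex1_pairI)
    show "h' \<in> Mor \<Lambda> \<and> u \<otimes> k \<in> Mor \<Lambda> \<and> Src \<Lambda> h' = Rng \<Lambda> (u \<otimes> k)
            \<and> Deg \<Lambda> h' = m \<and> Deg \<Lambda> (u \<otimes> k) = n \<and> f = Cmp \<Lambda> h' (u \<otimes> k)"
      using M rbu s C hk(4) uk by (simp add: Lambda_sel add_diff_pair)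
    fix g h2 assume "g \<in> Mor \<Lambda> \<and> h2 \<in> Mor \<Lambda> \<and> Src \<Lambda> g = Rng \<Lambda> h2
            \<and> Deg \<Lambda> g = m \<and> Deg \<Lambda> h2 = n \<and> f = Cmp \<Lambda> g h2"
    then have g: "g \<in> Mor \<Lambda>" "h2 \<in> Mor \<Lambda>" "s g = r h2" "\<delta> g - (1, 1) = m" "\<delta> h2 - (1, 1) = n"
        "f = Cmp \<Lambda> g h2" by (simp_all add: Lambda_sel)
    \<comment> \<open>Any other factorisation exhibits \<open>f\<close> as
      \<open>g \<otimes> b h2\<close> with the same shapes as \<open>h' \<otimes> k\<close>, so
      uniqueness in the group applies.\<close>
    have "\<delta> g = m + (1, 1)" using g add_diff_pair(3) Mor_Lambda by metis
    moreover have "\<delta> (b h2) = n" using g(5) Lambda_rb(5)[OF g(2)] add_diff_pair by metis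
    moreover have "f = g \<otimes> b h2" using comp_Lambda(1)[OF g(1-3)] g(6) by simp
    ultimately have "h' = g \<and> k = b h2"
      using factor_unique[of h' k g "b h2"] hk g(1) df \<open>f = g \<otimes> b h2\<close> Lambda_rb[OF g(2)] Mor_Lambda by simp
    then show "g = h' \<and> h2 = u \<otimes> k" using s g(3) Lambda_rb(3)[OF g(2)] by metis
  qed
qed

lemma cocycle_Lambda: "cocycle G \<Lambda> c"
  using Lambda_cs(1) Obj_rbcs(3) comp_Lambda(6) by (simp add: cocycle_def Lambda_sel)

section \<open>The 2-graph of pairs and the skew product\<close>

abbreviation "\<Sigma> \<equiv> Sigma_graph G \<delta>"
abbreviation "act \<equiv> Sigma_action G \<delta>"
abbreviation "Quot \<equiv> quotient_two_graph G act \<Sigma>"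

text \<open>The translation-invariant label of a pair. It is the second coordinate of
  \<open>to_skew\<close>, and on \<open>Mor \<Sigma>\<close> it distinguishes the orbits.\<close>

definition diff :: "'g \<times> 'g \<Rightarrow> 'g" where "diff e = inv (fst e) \<otimes> snd e"

lemma inv_mult_cancel [simp]: "x \<in> carrier G \<Longrightarrow> a \<in> carrier G \<Longrightarrow> inv x \<otimes> (x \<otimes> a) = a"
  "x \<in> carrier G \<Longrightarrow> a \<in> carrier G \<Longrightarrow> x \<otimes> (inv x \<otimes> a) = a"
  using m_assoc[of "inv x" x a] m_assoc[of x "inv x" a] by simp_all

lemma Mor_Sigma: "(x, y) \<in> Mor \<Sigma> \<longleftrightarrow> x \<in> carrier G \<and> y \<in> carrier G \<and> inv x \<otimes> y \<in> Mor \<Lambda>"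
  and Obj_Sigma: "(x, y) \<in> Obj \<Sigma> \<longleftrightarrow> x \<in> carrier G \<and> y \<in> carrier G \<and> inv x \<otimes> y \<in> Obj \<Lambda>"
  by (auto simp: Sigma_graph_def Mor_Lambda Obj_Lambda)

text \<open>The condition on \<open>z\<close> says that \<open>inv x \<otimes> y\<close> factors as
  \<open>inv x \<otimes> z\<close> times \<open>inv z \<otimes> y\<close> with the shapes that
  define \<open>r\<close>. The description of \<open>w\<close> by \<open>c\<close> below is
  analogous.\<close>

lemma is_Sigma_z_iff:
  assumes "(x, y) \<in> Mor \<Sigma>"
  shows "is_Sigma_z G \<delta> x y z \<longleftrightarrow> z = x \<otimes> r (inv x \<otimes> y)"
proof -
  have xy: "x \<in> carrier G" "y \<in> carrier G" "inv x \<otimes> y \<in> Mor \<Lambda>" using assms Mor_Sigma by auto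
  note Lambda_rb = Lambda_rb[OF xy(3)]
  show ?thesis
  proof
    assume z: "is_Sigma_z G \<delta> x y z"
    then have zG: "z \<in> carrier G" by (simp add: is_Sigma_z_def)
    have "inv x \<otimes> y = (inv x \<otimes> z) \<otimes> (inv z \<otimes> y)" using xy zG by (simp add: m_assoc)
    then have "r (inv x \<otimes> y) = inv x \<otimes> z"
      using Lambda_rb_eq(1)[of "inv x \<otimes> z" "inv z \<otimes> y"] z xy zG unfolding is_Sigma_z_def by simp
    then show "z = x \<otimes> r (inv x \<otimes> y)" using xy zG by simp
  next
    assume z: "z = x \<otimes> r (inv x \<otimes> y)"
    have "inv z \<otimes> y = inv (r (inv x \<otimes> y)) \<otimes> (r (inv x \<otimes> y) \<otimes> b (inv x \<otimes> y))"
      using z xy Lambda_rb by (simp add: inv_mult_group m_assoc)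
    also have "\<dots> = b (inv x \<otimes> y)" using Lambda_rb(1,2) by simp
    finally show "is_Sigma_z G \<delta> x y z" using z xy Lambda_rb by (simp add: is_Sigma_z_def)
  qed
qed

lemma is_Sigma_w_iff:
  assumes "(x, y) \<in> Mor \<Sigma>"
  shows "is_Sigma_w G \<delta> x y w \<longleftrightarrow> w = x \<otimes> c (inv x \<otimes> y)"
proof -
  have xy: "x \<in> carrier G" "y \<in> carrier G" "inv x \<otimes> y \<in> Mor \<Lambda>" using assms Mor_Sigma by auto
  note Lambda_cs = Lambda_cs[OF xy(3)]
  show ?thesis
  proof
    assume w: "is_Sigma_w G \<delta> x y w"
    then have wG: "w \<in> carrier G" by (simp add: is_Sigma_w_def)
    have "inv x \<otimes> y = (inv x \<otimes> w) \<otimes> (inv w \<otimes> y)" using xy wG by (simp add: m_assoc)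
    then have "c (inv x \<otimes> y) = inv x \<otimes> w"
      using Lambda_cs_eq(1)[of "inv x \<otimes> w" "inv w \<otimes> y"] w xy wG unfolding is_Sigma_w_def by simp
    then show "w = x \<otimes> c (inv x \<otimes> y)" using xy wG by simp
  next
    assume w: "w = x \<otimes> c (inv x \<otimes> y)"
    have "inv w \<otimes> y = inv (c (inv x \<otimes> y)) \<otimes> (c (inv x \<otimes> y) \<otimes> s (inv x \<otimes> y))"
      using w xy Lambda_cs by (simp add: inv_mult_group m_assoc)
    also have "\<dots> = s (inv x \<otimes> y)" using Lambda_cs(1,2) by simp
    finally show "is_Sigma_w G \<delta> x y w" using w xy Lambda_cs by (simp add: is_Sigma_w_def)
  qed
qed

lemma Rng_Sigma: "(x, y) \<in> Mor \<Sigma> \<Longrightarrow> Rng \<Sigma> (x, y) = (x, x \<otimes> r (inv x \<otimes> y))"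
  and Src_Sigma: "(x, y) \<in> Mor \<Sigma> \<Longrightarrow> Src \<Sigma> (x, y) = (x \<otimes> c (inv x \<otimes> y), y)"
proof -
  assume xy: "(x, y) \<in> Mor \<Sigma>"
  have "Rng \<Sigma> (x, y) = (x, THE z. is_Sigma_z G \<delta> x y z)"
    "Src \<Sigma> (x, y) = (THE w. is_Sigma_w G \<delta> x y w, y)"
    by (simp_all add: Sigma_graph_def)
  then show "Rng \<Sigma> (x, y) = (x, x \<otimes> r (inv x \<otimes> y))"
    "Src \<Sigma> (x, y) = (x \<otimes> c (inv x \<otimes> y), y)"
    by (simp_all only: is_Sigma_z_iff[OF xy] is_Sigma_w_iff[OF xy] the_eq_trivial)
qed

lemma Cmp_Sigma: "Cmp \<Sigma> (x, y) (u, v) = (x, v)"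
  and Deg_Sigma: "Deg \<Sigma> (x, y) = Deg \<Lambda> (inv x \<otimes> y)"
  by (simp_all add: Sigma_graph_def Lambda_sel)

abbreviation "skew \<equiv> skew_product G c \<Lambda>"

definition to_skew :: "'g \<times> 'g \<Rightarrow> 'g \<times> 'g" where "to_skew e = (fst e, inv (fst e) \<otimes> snd e)"

lemma Mor_LambdaD: "f \<in> Mor \<Lambda> \<Longrightarrow> f \<in> carrier G" "f \<in> Obj \<Lambda> \<Longrightarrow> f \<in> carrier G"
  by (simp_all add: Mor_Lambda Obj_Lambda)

text \<open>This computes the label of the source of \<open>(x, y)\<close>.\<close>

lemma inv_mult_eq:
  assumes "x \<in> carrier G" "y \<in> carrier G" "inv x \<otimes> y \<in> Mor \<Lambda>"
  shows "inv (x \<otimes> c (inv x \<otimes> y)) \<otimes> y = s (inv x \<otimes> y)"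
proof -
  let ?f = "inv x \<otimes> y"
  have "inv (x \<otimes> c ?f) \<otimes> y = inv (c ?f) \<otimes> (c ?f \<otimes> s ?f)"
    using assms Lambda_cs[OF assms(3)] by (simp add: inv_mult_group m_assoc)
  then show ?thesis using Lambda_cs(1,2)[OF assms(3)] by simp
qed

text \<open>With \<open>f\<close> and \<open>g\<close> the two labels, composability means
  \<open>u = x \<otimes> c f\<close> and \<open>y = u \<otimes> r g\<close>. The first gives
  \<open>inv x \<otimes> v = c f \<otimes> g\<close>; together they give \<open>s f = r g\<close>,
  so this element is the composite \<open>f \<otimes> b g\<close>.\<close>

lemma comp_Sigma:
  assumes "(x, y) \<in> Mor \<Sigma>" "(u, v) \<in> Mor \<Sigma>" "Src \<Sigma> (x, y) = Rng \<Sigma> (u, v)"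
  shows "s (inv x \<otimes> y) = r (inv u \<otimes> v)"
    "inv x \<otimes> v = Cmp \<Lambda> (inv x \<otimes> y) (inv u \<otimes> v)" "(x, v) \<in> Mor \<Sigma>"
proof -
  let ?f = "inv x \<otimes> y" and ?g = "inv u \<otimes> v"
  have xy: "x \<in> carrier G" "y \<in> carrier G" "?f \<in> Mor \<Lambda>" and uv: "u \<in> carrier G" "v \<in> carrier G" "?g \<in> Mor \<Lambda>"
    using assms Mor_Sigma by auto
  note f = Lambda_cs[OF xy(3)] and g = Lambda_rb[OF uv(3)]
  have u: "u = x \<otimes> c ?f" and y: "y = u \<otimes> r ?g"
    using assms(3) Src_Sigma[OF assms(1)] Rng_Sigma[OF assms(2)] by auto
  have "s ?f = inv u \<otimes> y" using inv_mult_eq[OF xy] u by simp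
  then show sr: "s ?f = r ?g" using y uv(1) g(1) by (metis inv_mult_cancel(1))
  have "inv x \<otimes> v = inv x \<otimes> (u \<otimes> ?g)" using uv by simp
  also have "\<dots> = c ?f \<otimes> ?g" using xy f(1) Mor_LambdaD(1)[OF uv(3)] unfolding u
    by (simp add: m_assoc)
  also have "\<dots> = c ?f \<otimes> (s ?f \<otimes> b ?g)" using sr g(3) by simp
  also have "\<dots> = ?f \<otimes> b ?g" using f g(2) by (metis m_assoc)
  finally show e: "inv x \<otimes> v = Cmp \<Lambda> ?f ?g" using comp_Lambda(1)[OF xy(3) uv(3) sr] by simp
  show "(x, v) \<in> Mor \<Sigma>" using Mor_Sigma xy uv e comp_Lambda(2)[OF xy(3) uv(3) sr] by simp
qed

text \<open>Through the transport lemma this also shows that the pair graph satisfies the 2-graph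
  axioms.\<close>

lemma two_graph_iso_to_skew: "two_graph_iso \<Sigma> skew to_skew"
proof (rule two_graph_iso_transport)
  have L: "two_graph \<Lambda>" by (rule two_graph_Lambda)
  show "two_graph skew" by (rule two_graph_skew_product[OF is_group L cocycle_Lambda])
  have *: "to_skew (x, x \<otimes> f) = (x, f)" "inv x \<otimes> (x \<otimes> f) = f" if "x \<in> carrier G" "f \<in> carrier G" for x f
    using that by (simp_all add: to_skew_def)
  show "bij_betw to_skew (Mor \<Sigma>) (Mor skew)"
    by (rule bij_betw_byWitness[where f' = "\<lambda>(x, f). (x, x \<otimes> f)"])
      (auto simp: to_skew_def Mor_Sigma skew_product_def Mor_LambdaD)
  show "to_skew ` Obj \<Sigma> = Obj skew"
  proof
    show "to_skew ` Obj \<Sigma> \<subseteq> Obj skew" by (auto simp: to_skew_def Obj_Sigma skew_product_def)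
    show "Obj skew \<subseteq> to_skew ` Obj \<Sigma>"
    proof
      fix p assume "p \<in> Obj skew"
      then obtain x f where p: "p = (x, f)" "x \<in> carrier G" "f \<in> Obj \<Lambda>" by (auto simp: skew_product_def)
      then have "p = to_skew (x, x \<otimes> f)" "(x, x \<otimes> f) \<in> Obj \<Sigma>"
        using * Mor_LambdaD by (auto simp: Obj_Sigma)
      then show "p \<in> to_skew ` Obj \<Sigma>" by blast
    qed
  qed
  show "Obj \<Sigma> \<subseteq> Mor \<Sigma>" using two_graph.Obj_subset[OF L] by (auto simp: Obj_Sigma Mor_Sigma)
  fix e assume e: "e \<in> Mor \<Sigma>"
  obtain x y where xy: "e = (x, y)" by (cases e)
  have G: "x \<in> carrier G" "y \<in> carrier G" "inv x \<otimes> y \<in> Mor \<Lambda>" using e xy Mor_Sigma by auto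
  have RM: "r (inv x \<otimes> y) \<in> Mor \<Lambda>" "s (inv x \<otimes> y) \<in> Mor \<Lambda>"
    using two_graph.Rng_closed[OF L G(3)] two_graph.Src_closed[OF L G(3)] two_graph.Obj_subset[OF L]
    by (auto simp: Lambda_sel)
  show "Rng \<Sigma> e \<in> Mor \<Sigma> \<and> to_skew (Rng \<Sigma> e) = Rng skew (to_skew e)"
    using Rng_Sigma[of x y] e xy G RM Lambda_rb[OF G(3)] by (simp add: Mor_Sigma to_skew_def skew_product_def Lambda_sel)
  show "Src \<Sigma> e \<in> Mor \<Sigma> \<and> to_skew (Src \<Sigma> e) = Src skew (to_skew e)"
    using Src_Sigma[of x y] e xy G RM Lambda_cs[OF G(3)] inv_mult_eq[OF G]
    by (simp add: Mor_Sigma to_skew_def skew_product_def Lambda_sel)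
  show "Deg skew (to_skew e) = Deg \<Sigma> e"
    using xy by (simp add: to_skew_def skew_product_def Deg_Sigma)
  fix e' assume e': "e' \<in> Mor \<Sigma>" "Src \<Sigma> e = Rng \<Sigma> e'"
  obtain u v where uv: "e' = (u, v)" by (cases e')
  then show "Cmp \<Sigma> e e' \<in> Mor \<Sigma> \<and> to_skew (Cmp \<Sigma> e e') = Cmp skew (to_skew e) (to_skew e')"
    using comp_Sigma[of x y u v] e e' xy by (simp add: Cmp_Sigma to_skew_def skew_product_def)
qed

lemma two_graph_Sigma: "two_graph \<Sigma>"
  using two_graph_iso_to_skew by (simp add: two_graph_iso_def)

section \<open>The translation action\<close>

lemma diff_translate:
  assumes "g \<in> carrier G" "x \<in> carrier G" "y \<in> carrier G"
  shows "inv (g \<otimes> x) \<otimes> (g \<otimes> y) = inv x \<otimes> y"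
  using assms by (simp add: inv_mult_group m_assoc)

lemma act_eq: "(x, y) \<in> Mor \<Sigma> \<Longrightarrow> act g (x, y) = (g \<otimes> x, g \<otimes> y)"
  by (simp add: Sigma_action_def)

lemma act_Mor: "g \<in> carrier G \<Longrightarrow> (x, y) \<in> Mor \<Sigma> \<Longrightarrow> (g \<otimes> x, g \<otimes> y) \<in> Mor \<Sigma>"
  by (simp add: Mor_Sigma diff_translate)

lemma act_act:
  assumes "e \<in> Mor \<Sigma>"
  shows "h \<in> carrier G \<Longrightarrow> act h e \<in> Mor \<Sigma>"
    "g \<in> carrier G \<Longrightarrow> h \<in> carrier G \<Longrightarrow> act g (act h e) = act (g \<otimes> h) e" "act \<one> e = e"
proof -
  obtain x y where xy: "e = (x, y)" by (cases e)
  have G: "x \<in> carrier G" "y \<in> carrier G" using assms xy Mor_Sigma by auto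
  show "h \<in> carrier G \<Longrightarrow> act h e \<in> Mor \<Sigma>"
    "g \<in> carrier G \<Longrightarrow> h \<in> carrier G \<Longrightarrow> act g (act h e) = act (g \<otimes> h) e" "act \<one> e = e"
    using assms G unfolding xy by (simp_all add: act_eq act_Mor m_assoc)
qed

lemma bij_act:
  assumes "g \<in> carrier G"
  shows "bij_betw (act g) (Mor \<Sigma>) (Mor \<Sigma>)"
  by (rule bij_betw_byWitness[where f' = "act (inv g)"]) (use assms in \<open>auto simp: act_act\<close>)

lemma group_action_act: "group_action G (Mor \<Sigma>) act"
  unfolding group_action_def group_hom_def group_hom_axioms_def hom_def
proof (intro conjI is_group group_BijGroup CollectI Pi_I ballI)
  have Bij: "act g \<in> Bij (Mor \<Sigma>)" if "g \<in> carrier G" for g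
    using bij_act[OF that] by (auto simp: Bij_def Sigma_action_def)
  fix g assume g: "g \<in> carrier G"
  show "act g \<in> carrier (BijGroup (Mor \<Sigma>))" using Bij[OF g] by (simp add: BijGroup_def)
  fix h assume h: "h \<in> carrier G"
  have "act (g \<otimes> h) = compose (Mor \<Sigma>) (act g) (act h)"
    by (rule extensionalityI[where A = "Mor \<Sigma>"])
      (use g h in \<open>auto simp: act_act compose_eq Sigma_action_def[of _ _ "_ \<otimes> _"]\<close>)
  then show "act (g \<otimes> h) = act g \<otimes>\<^bsub>BijGroup (Mor \<Sigma>)\<^esub> act h"
    using Bij g h by (simp add: BijGroup_def)
qed

text \<open>Range, source and degree are computed from the label, which translation leaves
  unchanged; composition only selects outer coordinates.\<close>

lemma two_graph_iso_act:
  assumes g: "g \<in> carrier G"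
  shows "two_graph_iso \<Sigma> \<Sigma> (act g)"
proof (rule two_graph_iso_transport)
  interpret \<Sigma>: two_graph \<Sigma> by (rule two_graph_Sigma)
  show "two_graph \<Sigma>" by (rule two_graph_Sigma)
  show "bij_betw (act g) (Mor \<Sigma>) (Mor \<Sigma>)" by (rule bij_act[OF g])
  show OM: "Obj \<Sigma> \<subseteq> Mor \<Sigma>" by (rule \<Sigma>.Obj_subset)
  have obj: "act g' ` Obj \<Sigma> \<subseteq> Obj \<Sigma>" if "g' \<in> carrier G" for g'
    using OM that by (auto simp: act_eq Obj_Sigma diff_translate subset_iff)
  show "act g ` Obj \<Sigma> = Obj \<Sigma>"
  proof
    show "Obj \<Sigma> \<subseteq> act g ` Obj \<Sigma>"
    proof
      fix e assume e: "e \<in> Obj \<Sigma>"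
      obtain x y where xy: "e = (x, y)" by (cases e)
      have "(inv g \<otimes> x, inv g \<otimes> y) \<in> Obj \<Sigma>" using e xy g by (simp add: Obj_Sigma diff_translate)
      moreover have "act g (inv g \<otimes> x, inv g \<otimes> y) = e"
        using calculation OM e xy g by (auto simp: act_eq Obj_Sigma subset_iff)
      ultimately show "e \<in> act g ` Obj \<Sigma>" by force
    qed
  qed (rule obj[OF g])
  fix e assume e: "e \<in> Mor \<Sigma>"
  obtain x y where xy: "e = (x, y)" by (cases e)
  have G: "x \<in> carrier G" "y \<in> carrier G" "inv x \<otimes> y \<in> Mor \<Lambda>" using e xy Mor_Sigma by auto
  have R: "Rng \<Sigma> e \<in> Mor \<Sigma>" and S: "Src \<Sigma> e \<in> Mor \<Sigma>"
    using e \<Sigma>.Rng_closed \<Sigma>.Src_closed OM by blast+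
  show "Rng \<Sigma> e \<in> Mor \<Sigma> \<and> act g (Rng \<Sigma> e) = Rng \<Sigma> (act g e)"
    using R e xy g G Lambda_rb[OF G(3)] by (simp add: act_eq act_Mor Rng_Sigma diff_translate m_assoc)
  show "Src \<Sigma> e \<in> Mor \<Sigma> \<and> act g (Src \<Sigma> e) = Src \<Sigma> (act g e)"
    using S e xy g G Lambda_cs[OF G(3)] by (simp add: act_eq act_Mor Src_Sigma diff_translate m_assoc)
  show "Deg \<Sigma> (act g e) = Deg \<Sigma> e"
    using e xy g G by (simp add: act_eq Deg_Sigma diff_translate)
  fix e' assume e': "e' \<in> Mor \<Sigma>" "Src \<Sigma> e = Rng \<Sigma> e'"
  obtain u v where uv: "e' = (u, v)" by (cases e')
  then show "Cmp \<Sigma> e e' \<in> Mor \<Sigma> \<and> act g (Cmp \<Sigma> e e') = Cmp \<Sigma> (act g e) (act g e')"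
    using comp_Sigma(3)[of x y u v] e e' xy by (simp add: Cmp_Sigma act_eq)
qed

lemma free_act: "free_two_graph_action G \<Sigma> act"
  unfolding free_two_graph_action_def
proof (intro conjI ballI impI)
  show "g = \<one>" if "g \<in> carrier G" "e \<in> Mor \<Sigma>" "act g e = e" for g e
    using that by (cases e) (auto simp: act_eq Mor_Sigma r_cancel_one)
qed (rule group_action_act, rule two_graph_iso_act)

section \<open>Orbits and the quotient\<close>

definition fibre :: "'g \<Rightarrow> ('g \<times> 'g) set" where
  "fibre f = {e \<in> Mor \<Sigma>. diff e = f}"

text \<open>If \<open>(x, y)\<close> and \<open>(u, v)\<close> have the same label, translation by
  \<open>u \<otimes> inv x\<close> carries the first to the second.\<close>

lemma orbit_act:
  assumes "e \<in> Mor \<Sigma>"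
  shows "orbit G act e = fibre (diff e)"
proof -
  obtain x y where xy: "e = (x, y)" by (cases e)
  have G: "x \<in> carrier G" "y \<in> carrier G" "inv x \<otimes> y \<in> Mor \<Lambda>" using assms xy Mor_Sigma by auto
  show ?thesis
  proof
    show "orbit G act e \<subseteq> fibre (diff e)"
      using assms xy G by (auto simp: orbit_def fibre_def diff_def act_eq act_Mor diff_translate)
    show "fibre (diff e) \<subseteq> orbit G act e"
    proof
      fix e' assume e': "e' \<in> fibre (diff e)"
      obtain u v where uv: "e' = (u, v)" by (cases e')
      then have H: "u \<in> carrier G" "v \<in> carrier G" "inv u \<otimes> v = inv x \<otimes> y"
        using e' xy by (auto simp: fibre_def diff_def Mor_Sigma)
      have "u \<otimes> (inv x \<otimes> y) = v" using G H by (metis inv_mult_cancel(2))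
      then have "act (u \<otimes> inv x) e = e'" using assms xy uv G H by (simp add: act_eq m_assoc)
      then show "e' \<in> orbit G act e" using G H unfolding orbit_def by force
    qed
  qed
qed

lemma rep_fibre: "x \<in> carrier G \<Longrightarrow> f \<in> Mor \<Lambda> \<Longrightarrow> (x, x \<otimes> f) \<in> fibre f"
  by (simp add: fibre_def diff_def Mor_Sigma Mor_LambdaD)

lemma diff_Mor: "e \<in> Mor \<Sigma> \<Longrightarrow> diff e \<in> Mor \<Lambda>" "e \<in> Obj \<Sigma> \<Longrightarrow> diff e \<in> Obj \<Lambda>"
  by (cases e; simp add: diff_def Mor_Sigma Obj_Sigma)+

lemma diff_Rng: "e \<in> Mor \<Sigma> \<Longrightarrow> diff (Rng \<Sigma> e) = Rng \<Lambda> (diff e)"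
  and diff_Src: "e \<in> Mor \<Sigma> \<Longrightarrow> diff (Src \<Sigma> e) = Src \<Lambda> (diff e)"
  and diff_Deg: "e \<in> Mor \<Sigma> \<Longrightarrow> Deg \<Sigma> e = Deg \<Lambda> (diff e)"
proof -
  assume e: "e \<in> Mor \<Sigma>"
  obtain x y where xy: "e = (x, y)" by (cases e)
  have G: "x \<in> carrier G" "y \<in> carrier G" "inv x \<otimes> y \<in> Mor \<Lambda>" using e xy Mor_Sigma by auto
  show "diff (Rng \<Sigma> e) = Rng \<Lambda> (diff e)" "diff (Src \<Sigma> e) = Src \<Lambda> (diff e)" "Deg \<Sigma> e = Deg \<Lambda> (diff e)"
    using e xy G Lambda_rb[OF G(3)] inv_mult_eq[OF G]
    by (simp_all add: Rng_Sigma Src_Sigma Deg_Sigma diff_def Lambda_sel)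
qed

lemma diff_Cmp:
  assumes "e \<in> Mor \<Sigma>" "e' \<in> Mor \<Sigma>" "Src \<Sigma> e = Rng \<Sigma> e'"
  shows "Cmp \<Sigma> e e' \<in> Mor \<Sigma>" "diff (Cmp \<Sigma> e e') = Cmp \<Lambda> (diff e) (diff e')"
proof -
  obtain x y u v where e: "e = (x, y)" "e' = (u, v)" by (cases e, cases e')
  show "Cmp \<Sigma> e e' \<in> Mor \<Sigma>" "diff (Cmp \<Sigma> e e') = Cmp \<Lambda> (diff e) (diff e')"
    using comp_Sigma[of x y u v] assms unfolding e by (simp_all add: Cmp_Sigma diff_def)
qed

lemma Rng_Src_Mor:
  assumes "e \<in> Mor \<Sigma>"
  shows "Rng \<Sigma> e \<in> Mor \<Sigma>" "Src \<Sigma> e \<in> Mor \<Sigma>"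
  using two_graph.Rng_closed[OF two_graph_Sigma assms] two_graph.Src_closed[OF two_graph_Sigma assms]
    two_graph.Obj_subset[OF two_graph_Sigma] by blast+

lemma Mor_Quot: "Mor Quot = fibre ` Mor \<Lambda>" and Obj_Quot: "Obj Quot = fibre ` Obj \<Lambda>"
proof -
  have OM: "Obj \<Sigma> \<subseteq> Mor \<Sigma>" by (rule two_graph.Obj_subset[OF two_graph_Sigma])
  have 1: "\<exists>e\<in>Mor \<Sigma>. diff e = f" if "f \<in> Mor \<Lambda>" for f
    using rep_fibre[OF one_closed that] by (auto simp: fibre_def)
  have 2: "\<exists>e\<in>Obj \<Sigma>. diff e = f" if "f \<in> Obj \<Lambda>" for f
    by (rule bexI[of _ "(\<one>, f)"]) (use that Mor_LambdaD in \<open>auto simp: diff_def Obj_Sigma\<close>)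
  have "Mor Quot = (\<lambda>e. orbit G act e) ` Mor \<Sigma>" "Obj Quot = (\<lambda>e. orbit G act e) ` Obj \<Sigma>"
    by (auto simp: quotient_two_graph_def orbits_def)
  then have "Mor Quot = (\<lambda>e. fibre (diff e)) ` Mor \<Sigma>" "Obj Quot = (\<lambda>e. fibre (diff e)) ` Obj \<Sigma>"
    using orbit_act OM by (auto intro!: image_cong)
  moreover have "diff ` Mor \<Sigma> = Mor \<Lambda>" "diff ` Obj \<Sigma> = Obj \<Lambda>"
    using 1 2 diff_Mor by blast+
  ultimately show "Mor Quot = fibre ` Mor \<Lambda>" "Obj Quot = fibre ` Obj \<Lambda>"
    by (metis image_image)+
qed

text \<open>The range and source maps of the quotient are unions over representatives. The fibre is
  non-empty, so a union that is constant along it collapses to its value.\<close>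

lemma fibre_const: "f \<in> Mor \<Lambda> \<Longrightarrow> (\<And>e. e \<in> fibre f \<Longrightarrow> F e = A) \<Longrightarrow> (\<Union>e\<in>fibre f. F e) = A"
  using rep_fibre[OF one_closed] by blast

lemma Rng_Quot: "f \<in> Mor \<Lambda> \<Longrightarrow> Rng Quot (fibre f) = fibre (Rng \<Lambda> f)"
  and Src_Quot: "f \<in> Mor \<Lambda> \<Longrightarrow> Src Quot (fibre f) = fibre (Src \<Lambda> f)"
proof -
  assume f: "f \<in> Mor \<Lambda>"
  have "orbit G act (Rng \<Sigma> e) = fibre (Rng \<Lambda> f)" "orbit G act (Src \<Sigma> e) = fibre (Src \<Lambda> f)"
    if "e \<in> fibre f" for e
    using that by (auto simp: fibre_def[of f] orbit_act Rng_Src_Mor diff_Rng diff_Src)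
  then have "(\<Union>e\<in>fibre f. orbit G act (Rng \<Sigma> e)) = fibre (Rng \<Lambda> f)"
    "(\<Union>e\<in>fibre f. orbit G act (Src \<Sigma> e)) = fibre (Src \<Lambda> f)"
    by (intro fibre_const[OF f]; blast)+
  then show "Rng Quot (fibre f) = fibre (Rng \<Lambda> f)" "Src Quot (fibre f) = fibre (Src \<Lambda> f)"
    by (simp_all add: quotient_two_graph_def)
qed

lemma Deg_Quot: "f \<in> Mor \<Lambda> \<Longrightarrow> Deg Quot (fibre f) = Deg \<Lambda> f"
proof -
  assume f: "f \<in> Mor \<Lambda>"
  then have "Deg \<Sigma> ` fibre f = {Deg \<Lambda> f}"
    using rep_fibre[OF one_closed f] by (force simp: fibre_def diff_Deg)
  then show ?thesis by (simp add: quotient_two_graph_def)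
qed

lemma fibre_inject: "f \<in> Mor \<Lambda> \<Longrightarrow> fibre f = fibre g \<Longrightarrow> f = g"
proof -
  assume f: "f \<in> Mor \<Lambda>" and eq: "fibre f = fibre g"
  have "(\<one>, \<one> \<otimes> f) \<in> fibre f \<inter> fibre g" using rep_fibre[OF one_closed f] eq by simp
  then show "f = g" unfolding fibre_def by (metis (mono_tags, lifting) IntE mem_Collect_eq)
qed

lemma Cmp_Quot:
  assumes "f \<in> Mor \<Lambda>" "g \<in> Mor \<Lambda>" "Src \<Lambda> f = Rng \<Lambda> g"
  shows "Cmp Quot (fibre f) (fibre g) = fibre (Cmp \<Lambda> f g)"
proof
  show "Cmp Quot (fibre f) (fibre g) \<subseteq> fibre (Cmp \<Lambda> f g)"
    by (auto simp: quotient_two_graph_def fibre_def[of f] fibre_def[of g] orbit_act diff_Cmp)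
  \<comment> \<open>Composable representatives: the source of \<open>(\<one>, f)\<close> is the
    vertex \<open>(c f, f)\<close>, so the representative of \<open>g\<close> must start at
    \<open>c f\<close>.\<close>
  let ?e = "(\<one>, f)" and ?e' = "(c f, c f \<otimes> g)"
  have G: "f \<in> carrier G" "g \<in> carrier G" using assms Mor_LambdaD by blast+
  have e: "?e \<in> fibre f" "?e' \<in> fibre g"
    using rep_fibre[OF one_closed assms(1)] rep_fibre[OF Lambda_cs(1)[OF assms(1)] assms(2)] G by simp_all
  then have M: "?e \<in> Mor \<Sigma>" "?e' \<in> Mor \<Sigma>" "diff ?e = f" "diff ?e' = g" by (auto simp: fibre_def)
  have "Src \<Sigma> ?e = Rng \<Sigma> ?e'"
    using Src_Sigma[OF M(1)] Rng_Sigma[OF M(2)] G assms Lambda_cs[OF assms(1)] by (simp add: Lambda_sel)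
  moreover have "orbit G act (Cmp \<Sigma> ?e ?e') = fibre (Cmp \<Lambda> f g)"
    using orbit_act diff_Cmp[OF M(1,2) calculation] M by simp
  ultimately show "fibre (Cmp \<Lambda> f g) \<subseteq> Cmp Quot (fibre f) (fibre g)"
    using e by (force simp: quotient_two_graph_def)
qed

definition orbit_diff :: "('g \<times> 'g) set \<Rightarrow> 'g" where
  "orbit_diff A = the_elem (diff ` A)"

lemma orbit_diff_fibre: "f \<in> Mor \<Lambda> \<Longrightarrow> orbit_diff (fibre f) = f"
proof -
  assume "f \<in> Mor \<Lambda>"
  then have "diff ` fibre f = {f}" using rep_fibre[OF one_closed, of f] by (force simp: fibre_def)
  then show ?thesis by (simp add: orbit_diff_def)
qed

text \<open>The orbits are the fibres of \<open>diff\<close>, and \<open>diff\<close> respects the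
  structure maps, so the quotient is a copy of \<open>\<Lambda>\<close> and inherits its axioms by
  transport.\<close>

lemma two_graph_iso_orbit_diff: "two_graph_iso Quot \<Lambda> orbit_diff"
proof (rule two_graph_iso_transport)
  interpret \<Lambda>: two_graph \<Lambda> by (rule two_graph_Lambda)
  note OM = subsetD[OF \<Lambda>.Obj_subset]
  show "two_graph \<Lambda>" by (rule two_graph_Lambda)
  show "bij_betw orbit_diff (Mor Quot) (Mor \<Lambda>)"
    by (rule bij_betw_byWitness[where f' = fibre]) (auto simp: Mor_Quot orbit_diff_fibre)
  show "orbit_diff ` Obj Quot = Obj \<Lambda>"
    using OM by (force simp: Obj_Quot orbit_diff_fibre image_image)
  show "Obj Quot \<subseteq> Mor Quot" using OM by (auto simp: Obj_Quot Mor_Quot)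
  fix A assume "A \<in> Mor Quot"
  then obtain f where f: "A = fibre f" "f \<in> Mor \<Lambda>" by (auto simp: Mor_Quot)
  note RS = \<Lambda>.Rng_closed[OF f(2), THEN OM] \<Lambda>.Src_closed[OF f(2), THEN OM]
  show "Rng Quot A \<in> Mor Quot \<and> orbit_diff (Rng Quot A) = Rng \<Lambda> (orbit_diff A)"
    "Src Quot A \<in> Mor Quot \<and> orbit_diff (Src Quot A) = Src \<Lambda> (orbit_diff A)"
    "Deg \<Lambda> (orbit_diff A) = Deg Quot A"
    using f RS by (simp_all add: Rng_Quot Src_Quot Deg_Quot orbit_diff_fibre Mor_Quot)
  fix B assume B: "B \<in> Mor Quot" "Src Quot A = Rng Quot B"
  then obtain g where g: "B = fibre g" "g \<in> Mor \<Lambda>" by (auto simp: Mor_Quot)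
  have sr: "Src \<Lambda> f = Rng \<Lambda> g" using B(2) f g RS fibre_inject by (simp add: Rng_Quot Src_Quot)
  then show "Cmp Quot A B \<in> Mor Quot \<and> orbit_diff (Cmp Quot A B) = Cmp \<Lambda> (orbit_diff A) (orbit_diff B)"
    using f g \<Lambda>.Cmp_closed[OF f(2) g(2) sr] by (simp add: Cmp_Quot orbit_diff_fibre Mor_Quot)
qed

text \<open>Valid for any group with a shape function as above; the witnesses are
  \<open>to_skew\<close> and the map \<open>orbit_diff\<close> that reads the label of an
  orbit.\<close>

theorem Sigma_skew_product_quotient:
  "(\<forall>(x, y)\<in>Mor \<Sigma>. (\<exists>!z. is_Sigma_z G \<delta> x y z) \<and> (\<exists>!w. is_Sigma_w G \<delta> x y w))
    \<and> two_graph \<Sigma>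
    \<and> cocycle G \<Lambda> c
    \<and> free_two_graph_action G \<Sigma> act
    \<and> (\<exists>\<phi>. two_graph_iso \<Sigma> (skew_product G c \<Lambda>) \<phi>
          \<and> (\<forall>(x, y)\<in>Mor \<Sigma>. \<phi> (x, y) = (x, inv x \<otimes> y))
          \<and> (\<forall>(x, f)\<in>Mor (skew_product G c \<Lambda>).
                inv_into (Mor \<Sigma>) \<phi> (x, f) = (x, x \<otimes> f))
          \<and> (\<forall>g\<in>carrier G. \<forall>e\<in>Mor \<Sigma>.
                \<phi> (act g e) = skew_translation G c \<Lambda> g (\<phi> e))
          \<and> (\<exists>\<psi>. two_graph_iso (quotient_two_graph G act \<Sigma>) \<Lambda> \<psi>
                \<and> (\<forall>e\<in>Mor \<Sigma>. \<psi> (orbit G act e) = snd (\<phi> e))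
                \<and> (\<forall>(x, y)\<in>Mor \<Sigma>. \<psi> (orbit G act (x, y)) = inv x \<otimes> y)))"
proof (intro conjI exI[of _ to_skew] exI[of _ orbit_diff])
  show "\<forall>(x, y)\<in>Mor \<Sigma>. (\<exists>!z. is_Sigma_z G \<delta> x y z) \<and> (\<exists>!w. is_Sigma_w G \<delta> x y w)"
    by (auto simp: is_Sigma_z_iff is_Sigma_w_iff)
  show "\<forall>(x, y)\<in>Mor \<Sigma>. to_skew (x, y) = (x, inv x \<otimes> y)" by (simp add: to_skew_def)
  have inj: "inj_on to_skew (Mor \<Sigma>)"
    using two_graph_iso_to_skew by (simp add: two_graph_iso_def bij_betw_def)
  show "\<forall>(x, f)\<in>Mor (skew_product G c \<Lambda>). inv_into (Mor \<Sigma>) to_skew (x, f) = (x, x \<otimes> f)"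
  proof clarify
    fix x f assume "(x, f) \<in> Mor (skew_product G c \<Lambda>)"
    then have xf: "x \<in> carrier G" "f \<in> Mor \<Lambda>" "f \<in> carrier G"
      using Mor_LambdaD by (auto simp: skew_product_def)
    show "inv_into (Mor \<Sigma>) to_skew (x, f) = (x, x \<otimes> f)"
      by (rule inv_into_f_eq[OF inj]) (use xf in \<open>simp_all add: Mor_Sigma to_skew_def\<close>)
  qed
  show "\<forall>g\<in>carrier G. \<forall>e\<in>Mor \<Sigma>. to_skew (act g e) = skew_translation G c \<Lambda> g (to_skew e)"
    by (auto simp: act_eq to_skew_def skew_translation_def skew_product_def Mor_Sigma diff_translate)
  show "\<forall>e\<in>Mor \<Sigma>. orbit_diff (orbit G act e) = snd (to_skew e)"
    "\<forall>(x, y)\<in>Mor \<Sigma>. orbit_diff (orbit G act (x, y)) = inv x \<otimes> y"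
    using diff_Mor orbit_diff_fibre by (auto simp: orbit_act to_skew_def diff_def)
qed (rule two_graph_Sigma cocycle_Lambda free_act two_graph_iso_to_skew two_graph_iso_orbit_diff)+

end

theorem proposition5p20:
  fixes P :: "'p set" and L :: "'l set" and on :: "'p \<Rightarrow> 'l \<Rightarrow> bool" and q :: nat
    and lam :: "'p \<Rightarrow> 'l" and T :: "('p \<times> 'p \<times> 'p) set"
  defines "\<Gamma> \<equiv> A2_group P T"
    and "\<delta> \<equiv> A2_shape P on lam T"
  defines "\<Lambda> \<equiv> Lambda_graph \<Gamma> \<delta>"
    and "\<Sigma> \<equiv> Sigma_graph \<Gamma> \<delta>"
    and "c \<equiv> Lambda_c \<Gamma> \<delta>"
    and "act \<equiv> Sigma_action \<Gamma> \<delta>"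
  assumes "triella P L on q lam T"
  shows "(\<forall>(x, y)\<in>Mor \<Sigma>. (\<exists>!z. is_Sigma_z \<Gamma> \<delta> x y z) \<and> (\<exists>!w. is_Sigma_w \<Gamma> \<delta> x y w))
    \<and> two_graph \<Sigma>
    \<and> cocycle \<Gamma> \<Lambda> c
    \<and> free_two_graph_action \<Gamma> \<Sigma> act
    \<and> (\<exists>\<phi>. two_graph_iso \<Sigma> (skew_product \<Gamma> c \<Lambda>) \<phi>
          \<and> (\<forall>(x, y)\<in>Mor \<Sigma>. \<phi> (x, y) = (x, inv\<^bsub>\<Gamma>\<^esub> x \<otimes>\<^bsub>\<Gamma>\<^esub> y))
          \<and> (\<forall>(x, f)\<in>Mor (skew_product \<Gamma> c \<Lambda>).
                inv_into (Mor \<Sigma>) \<phi> (x, f) = (x, x \<otimes>\<^bsub>\<Gamma>\<^esub> f))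
          \<and> (\<forall>g\<in>carrier \<Gamma>. \<forall>e\<in>Mor \<Sigma>.
                \<phi> (act g e) = skew_translation \<Gamma> c \<Lambda> g (\<phi> e))
          \<and> (\<exists>\<psi>. two_graph_iso (quotient_two_graph \<Gamma> act \<Sigma>) \<Lambda> \<psi>
                \<and> (\<forall>e\<in>Mor \<Sigma>. \<psi> (orbit \<Gamma> act e) = snd (\<phi> e))
                \<and> (\<forall>(x, y)\<in>Mor \<Sigma>. \<psi> (orbit \<Gamma> act (x, y)) = inv\<^bsub>\<Gamma>\<^esub> x \<otimes>\<^bsub>\<Gamma>\<^esub> y)))"
proof -
  interpret triella P L on q lam T by fact
  \<comment> \<open>The projective plane and the triella enter only through the shape function
    axioms.\<close>
  have "shape_group \<Gamma> \<delta>"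
    unfolding \<Gamma>_def \<delta>_def A2_shape_eq by (rule triangle_presentation.shape_group[OF triangle_presentation])
  then show ?thesis
    unfolding \<Lambda>_def \<Sigma>_def c_def act_def by (rule shape_group.Sigma_skew_product_quotient)
qed

end
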